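(* Let $K$ be a pre-$\operatorname{d}$-valued field of $H$-type. If $K$ is $\lambda$-free, then its differential-valued hull $\operatorname{dv}(K)$ is $\lambda$-free.
   Context: $\operatorname{dv}(K)$ is a $\operatorname{d}$-valued extension of $K$ of $H$-type such that any embedding of $K$ into a $\operatorname{d}$-valued field of $H$-type extends uniquely to $\operatorname{dv}(K)$. An ungrounded $H$-asymptotic field $K$ with value group $\Gamma\neq\{0\}$ is $\lambda$-free if for every $s\in K$ there is $g\succ1$ in $K$ with $s-(g^\dagger)^\dagger\succcurlyeq g^\dagger$, where $a^\dagger=a'/a$. *)

theory Defs
  imports "HOL-Algebra.Ring" "HOL-Algebra.RingHom"
begin

text \<open>Valued differential fields, following Aschenbrenner--van den Dries--van der Hoeven
  (ADH).  A structure consists of a field (HOL-Algebra ring record), a derivation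
  vder and a dominance relation vdom (vdom f g means f is dominated by g, i.e. v f \<ge> v g).\<close>

record 'a vdf = "'a ring" +
  vder :: "'a \<Rightarrow> 'a"
  vdom :: "'a \<Rightarrow> 'a \<Rightarrow> bool"

definition preceq :: "('a, 'b) vdf_scheme \<Rightarrow> 'a \<Rightarrow> 'a \<Rightarrow> bool" where
  "preceq K f g \<longleftrightarrow> vdom K f g"

definition prec :: "('a, 'b) vdf_scheme \<Rightarrow> 'a \<Rightarrow> 'a \<Rightarrow> bool" where
  "prec K f g \<longleftrightarrow> vdom K f g \<and> \<not> vdom K g f"

definition asymp :: "('a, 'b) vdf_scheme \<Rightarrow> 'a \<Rightarrow> 'a \<Rightarrow> bool" where
  "asymp K f g \<longleftrightarrow> vdom K f g \<and> vdom K g f"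

definition sim :: "('a, 'b) vdf_scheme \<Rightarrow> 'a \<Rightarrow> 'a \<Rightarrow> bool" where
  "sim K f g \<longleftrightarrow> prec K (f \<ominus>\<^bsub>K\<^esub> g) g"

definition ldv :: "('a, 'b) vdf_scheme \<Rightarrow> 'a \<Rightarrow> 'a" where
  "ldv K f = vder K f \<otimes>\<^bsub>K\<^esub> inv\<^bsub>K\<^esub> f"

definition dominance :: "('a, 'b) vdf_scheme \<Rightarrow> bool" where
  "dominance K \<longleftrightarrow>
     \<not> vdom K \<one>\<^bsub>K\<^esub> \<zero>\<^bsub>K\<^esub> \<and>
     (\<forall>f\<in>carrier K. vdom K f f) \<and>
     (\<forall>f\<in>carrier K. \<forall>g\<in>carrier K. \<forall>h\<in>carrier K.
        vdom K f g \<and> vdom K g h \<longrightarrow> vdom K f h) \<and>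
     (\<forall>f\<in>carrier K. \<forall>g\<in>carrier K. vdom K f g \<or> vdom K g f) \<and>
     (\<forall>f\<in>carrier K. \<forall>g\<in>carrier K. \<forall>h\<in>carrier K.
        vdom K f g \<longrightarrow> vdom K (f \<otimes>\<^bsub>K\<^esub> h) (g \<otimes>\<^bsub>K\<^esub> h)) \<and>
     (\<forall>f\<in>carrier K. \<forall>g\<in>carrier K. \<forall>h\<in>carrier K.
        vdom K f h \<and> vdom K g h \<longrightarrow> vdom K (f \<ominus>\<^bsub>K\<^esub> g) h)"

definition derivation :: "('a, 'b) vdf_scheme \<Rightarrow> bool" where
  "derivation K \<longleftrightarrow>
     vder K \<in> carrier K \<rightarrow> carrier K \<and>
     (\<forall>a\<in>carrier K. \<forall>b\<in>carrier K.
        vder K (a \<oplus>\<^bsub>K\<^esub> b) = vder K a \<oplus>\<^bsub>K\<^esub> vder K b) \<and>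
     (\<forall>a\<in>carrier K. \<forall>b\<in>carrier K.
        vder K (a \<otimes>\<^bsub>K\<^esub> b) = vder K a \<otimes>\<^bsub>K\<^esub> b \<oplus>\<^bsub>K\<^esub> a \<otimes>\<^bsub>K\<^esub> vder K b)"

definition valued_diff_field :: "('a, 'b) vdf_scheme \<Rightarrow> bool" where
  "valued_diff_field K \<longleftrightarrow> field K \<and> derivation K \<and> dominance K \<and>
     (\<forall>n::nat. n > 0 \<longrightarrow> add_pow K n \<one>\<^bsub>K\<^esub> \<noteq> \<zero>\<^bsub>K\<^esub>)"

abbreviation nonzero :: "('a, 'b) vdf_scheme \<Rightarrow> 'a set" where
  "nonzero K \<equiv> carrier K - {\<zero>\<^bsub>K\<^esub>}"

definition asymptotic :: "('a, 'b) vdf_scheme \<Rightarrow> bool" where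
  "asymptotic K \<longleftrightarrow> valued_diff_field K \<and>
     (\<forall>f\<in>nonzero K. \<forall>g\<in>nonzero K.
        prec K f \<one>\<^bsub>K\<^esub> \<and> prec K g \<one>\<^bsub>K\<^esub> \<longrightarrow>
        (prec K f g \<longleftrightarrow> prec K (vder K f) (vder K g)))"

definition H_type :: "('a, 'b) vdf_scheme \<Rightarrow> bool" where
  "H_type K \<longleftrightarrow> valued_diff_field K \<and>
     (\<forall>f\<in>nonzero K. \<forall>g\<in>nonzero K.
        prec K f g \<and> prec K g \<one>\<^bsub>K\<^esub> \<longrightarrow> preceq K (ldv K g) (ldv K f))"

definition H_asymptotic :: "('a, 'b) vdf_scheme \<Rightarrow> bool" where
  "H_asymptotic K \<longleftrightarrow> asymptotic K \<and> H_type K"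

definition pre_d_valued :: "('a, 'b) vdf_scheme \<Rightarrow> bool" where
  "pre_d_valued K \<longleftrightarrow> valued_diff_field K \<and>
     (\<forall>f\<in>carrier K. \<forall>g\<in>nonzero K.
        preceq K f \<one>\<^bsub>K\<^esub> \<and> prec K g \<one>\<^bsub>K\<^esub> \<longrightarrow> prec K (vder K f) (ldv K g))"

definition d_valued :: "('a, 'b) vdf_scheme \<Rightarrow> bool" where
  "d_valued K \<longleftrightarrow> asymptotic K \<and>
     (\<forall>f\<in>carrier K. asymp K f \<one>\<^bsub>K\<^esub> \<longrightarrow>
        (\<exists>c\<in>carrier K. vder K c = \<zero>\<^bsub>K\<^esub> \<and> sim K f c))"

definition nontrivial_value_group :: "('a, 'b) vdf_scheme \<Rightarrow> bool" where
  "nontrivial_value_group K \<longleftrightarrow> (\<exists>f\<in>nonzero K. \<not> asymp K f \<one>\<^bsub>K\<^esub>)"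

text \<open>Grounded: \<Psi> = {v(g\<dagger>) : g \<in> K^\<times>, v g \<noteq> 0} has a largest element.\<close>
definition grounded :: "('a, 'b) vdf_scheme \<Rightarrow> bool" where
  "grounded K \<longleftrightarrow> (\<exists>g\<in>nonzero K. \<not> asymp K g \<one>\<^bsub>K\<^esub> \<and>
     (\<forall>h\<in>nonzero K. \<not> asymp K h \<one>\<^bsub>K\<^esub> \<longrightarrow> preceq K (ldv K g) (ldv K h)))"

definition lambda_free :: "('a, 'b) vdf_scheme \<Rightarrow> bool" where
  "lambda_free K \<longleftrightarrow> H_asymptotic K \<and> \<not> grounded K \<and> nontrivial_value_group K \<and>
     (\<forall>s\<in>carrier K. \<exists>g\<in>carrier K. prec K \<one>\<^bsub>K\<^esub> g \<and>
        preceq K (ldv K g) (s \<ominus>\<^bsub>K\<^esub> ldv K (ldv K g)))"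

definition vdf_emb :: "('a \<Rightarrow> 'c) \<Rightarrow> ('a, 'b) vdf_scheme \<Rightarrow> ('c, 'd) vdf_scheme \<Rightarrow> bool" where
  "vdf_emb e K M \<longleftrightarrow> e \<in> ring_hom K M \<and>
     (\<forall>x\<in>carrier K. e (vder K x) = vder M (e x)) \<and>
     (\<forall>x\<in>carrier K. \<forall>y\<in>carrier K. vdom K x y \<longleftrightarrow> vdom M (e x) (e y))"

definition dv_hull :: "('k, 'b) vdf_scheme \<Rightarrow> 'a vdf \<Rightarrow> ('k \<Rightarrow> 'a) \<Rightarrow> bool" where
  "dv_hull K L i \<longleftrightarrow> d_valued L \<and> H_type L \<and> vdf_emb i K L \<and>
     (\<forall>(M::'a vdf) e. d_valued M \<and> H_type M \<and> vdf_emb e K M \<longrightarrow>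
        (\<exists>j. vdf_emb j L M \<and> (\<forall>x\<in>carrier K. j (i x) = e x) \<and>
           (\<forall>j'. vdf_emb j' L M \<and> (\<forall>x\<in>carrier K. j' (i x) = e x) \<longrightarrow>
              (\<forall>y\<in>carrier L. j' y = j y))))"

end

theory Submission
  imports Defs "HOL-Algebra.Subrings"
begin


text \<open>Identify \<open>K\<close> with its image \<open>F\<close> in \<open>L\<close>, and let \<open>C\<close> be the set of constants of \<open>L\<close> that are
  congruent to elements of \<open>F\<close> modulo infinitesimals.  In a sum \<open>w = f\<^sub>1 c\<^sub>1 + \<dots> + f\<^sub>n c\<^sub>n\<close> with
  \<open>f\<^sub>i \<in> F\<close> and \<open>c\<^sub>i \<in> C\<close>, normalized to \<open>f\<^sub>n = 1\<close>, differentiation removes the term \<open>c\<^sub>n\<close>.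
  Induction on \<open>n\<close> therefore shows that \<open>w\<close> is approximated by elements of \<open>F\<close>: either the
  approximations of \<open>c\<^sub>n\<close> and of the remaining sum add up without cancellation, or \<open>w \<prec> 1\<close> and
  an approximation of \<open>w\<close> is obtained by integrating one of \<open>w'\<close>.  Moreover the relative precision
  is uniform: one infinitesimal \<open>\<kappa> \<in> F\<close> serves all sums with given \<open>c\<^sub>1, \<dots>, c\<^sub>n\<close>.

  Hence \<open>F(C)\<close> is an immediate extension of \<open>F\<close>.  So it is differential-valued, and it is all
  of \<open>L\<close> by the universal property.  If \<open>s \<in> L\<close> were a counterexample to \<open>\<lambda>\<close>-freeness, take
  \<open>\<kappa>\<close> for \<open>s\<close> and \<open>g = 1/\<kappa>\<close>.  Improving the approximation \<open>g\<^sup>\<dagger>\<^sup>\<dagger>\<close> of \<open>s\<close> by the factor \<open>\<kappa>\<close> yields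
  \<open>b \<in> F\<close> with \<open>s - b \<prec> \<kappa> g\<^sup>\<dagger> = - \<kappa>'\<close>.  As \<open>\<kappa>' \<prec> h\<^sup>\<dagger>\<close> for all \<open>h \<succ> 1\<close>, this \<open>b\<close> would be a
  counterexample in \<open>F\<close>.\<close>

section \<open>Dominance relations\<close>

lemma (in field) inv_nonzero [simp]:
  assumes "x \<in> carrier R" "x \<noteq> \<zero>"
  shows "inv x \<in> carrier R" "inv x \<noteq> \<zero>" "x \<otimes> inv x = \<one>" "inv x \<otimes> x = \<one>"
proof -
  have u: "x \<in> Units R" using assms field_Units by simp
  then show "inv x \<in> carrier R" "x \<otimes> inv x = \<one>" "inv x \<otimes> x = \<one>" by auto
  show "inv x \<noteq> \<zero>" using Units_inv_Units[OF u] field_Units by simp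
qed

locale valued_field = field L for L :: "('a, 'b) vdf_scheme" (structure) +
  assumes dominance: "dominance L"
begin

abbreviation dom_le (infix "\<preceq>" 50) where "f \<preceq> g \<equiv> vdom L f g"
text \<open>On the carrier this agrees with \<open>prec\<close>, because dominance is total there;
  see \<open>prec_iff\<close>.\<close>

abbreviation dom_lt (infix "\<prec>" 50) where "f \<prec> g \<equiv> \<not> vdom L g f"

lemma dom_refl [simp]: "f \<in> carrier L \<Longrightarrow> f \<preceq> f"
  using dominance unfolding dominance_def by blast

lemma dom_trans [trans]:
  "f \<preceq> g \<Longrightarrow> g \<preceq> h \<Longrightarrow> f \<in> carrier L \<Longrightarrow> g \<in> carrier L \<Longrightarrow> h \<in> carrier L \<Longrightarrow> f \<preceq> h"
  using dominance[unfolded dominance_def, THEN conjunct2, THEN conjunct2, THEN conjunct1] by blast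

lemma dom_total: "f \<in> carrier L \<Longrightarrow> g \<in> carrier L \<Longrightarrow> f \<preceq> g \<or> g \<preceq> f"
  using dominance[unfolded dominance_def, THEN conjunct2, THEN conjunct2, THEN conjunct2, THEN conjunct1] by blast

lemma dom_mult_right:
  "f \<preceq> g \<Longrightarrow> f \<in> carrier L \<Longrightarrow> g \<in> carrier L \<Longrightarrow> h \<in> carrier L \<Longrightarrow> f \<otimes> h \<preceq> g \<otimes> h"
  using dominance[unfolded dominance_def, THEN conjunct2, THEN conjunct2, THEN conjunct2, THEN conjunct2, THEN conjunct1] by blast

lemma dom_diff:
  "f \<preceq> h \<Longrightarrow> g \<preceq> h \<Longrightarrow> f \<in> carrier L \<Longrightarrow> g \<in> carrier L \<Longrightarrow> h \<in> carrier L \<Longrightarrow> f \<ominus> g \<preceq> h"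
  using dominance[unfolded dominance_def, THEN conjunct2, THEN conjunct2, THEN conjunct2, THEN conjunct2, THEN conjunct2] by blast

lemma sdom_imp_dom: "f \<prec> g \<Longrightarrow> f \<in> carrier L \<Longrightarrow> g \<in> carrier L \<Longrightarrow> f \<preceq> g"
  using dom_total by blast

lemma sdom_trans:
  "f \<prec> g \<Longrightarrow> g \<prec> h \<Longrightarrow> f \<in> carrier L \<Longrightarrow> g \<in> carrier L \<Longrightarrow> h \<in> carrier L \<Longrightarrow> f \<prec> h"
  by (meson dom_trans dom_total)

lemma zero_dom [simp]: "h \<in> carrier L \<Longrightarrow> \<zero> \<preceq> h"
  using dom_diff[of h h h] by (simp add: minus_eq r_neg)

lemma one_not_dom_zero [simp]: "\<zero> \<prec> \<one>"
  using dominance unfolding dominance_def by blast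

lemma dom_zero: assumes "f \<preceq> \<zero>" "f \<in> carrier L" shows "f = \<zero>"
proof (rule ccontr)
  assume f: "f \<noteq> \<zero>"
  then have "f \<otimes> inv f \<preceq> \<zero> \<otimes> inv f" using assms by (intro dom_mult_right) auto
  then show False using f assms by simp
qed

lemma zero_sdom_iff: "f \<in> carrier L \<Longrightarrow> \<zero> \<prec> f \<longleftrightarrow> f \<noteq> \<zero>"
  using dom_zero by auto

lemma dom_cancel_right:
  assumes "h \<noteq> \<zero>" "f \<in> carrier L" "g \<in> carrier L" "h \<in> carrier L"
  shows "f \<otimes> h \<preceq> g \<otimes> h \<longleftrightarrow> f \<preceq> g"
proof
  assume "f \<otimes> h \<preceq> g \<otimes> h"
  then have "f \<otimes> h \<otimes> inv h \<preceq> g \<otimes> h \<otimes> inv h" using assms by (simp add: dom_mult_right)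
  then show "f \<preceq> g" using assms by (simp add: m_assoc)
qed (use assms dom_mult_right in auto)

lemma dom_cancel_left:
  assumes "h \<noteq> \<zero>" "f \<in> carrier L" "g \<in> carrier L" "h \<in> carrier L"
  shows "h \<otimes> f \<preceq> h \<otimes> g \<longleftrightarrow> f \<preceq> g"
  using dom_cancel_right[OF assms] assms by (simp add: m_comm)

lemma dom_mult:
  assumes "f \<preceq> g" "f' \<preceq> g'"
    "f \<in> carrier L" "g \<in> carrier L" "f' \<in> carrier L" "g' \<in> carrier L"
  shows "f \<otimes> f' \<preceq> g \<otimes> g'"
proof -
  have "f \<otimes> f' \<preceq> g \<otimes> f'" using assms dom_mult_right by blast
  moreover have "g \<otimes> f' \<preceq> g \<otimes> g'"
    using dom_mult_right[of f' g' g] assms by (simp add: m_comm)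
  ultimately show ?thesis using assms by (meson dom_trans m_closed)
qed

lemma dom_mult_le:
  assumes "f \<preceq> h" "g \<preceq> \<one>" "f \<in> carrier L" "g \<in> carrier L" "h \<in> carrier L"
  shows "f \<otimes> g \<preceq> h" "g \<otimes> f \<preceq> h"
  using dom_mult[of f h g \<one>] assms by (simp_all add: m_comm)

lemma dom_minus_iff [simp]:
  assumes "f \<in> carrier L" "h \<in> carrier L" shows "\<ominus> f \<preceq> h \<longleftrightarrow> f \<preceq> h"
proof -
  have imp: "\<ominus> g \<preceq> h" if "g \<preceq> h" "g \<in> carrier L" for g
    using dom_diff[of \<zero> h g] that assms by (simp add: minus_eq)
  show ?thesis using imp[of f] imp[of "\<ominus> f"] assms by auto
qed

lemma minus_dom_iff [simp]:
  assumes "f \<in> carrier L" "h \<in> carrier L" shows "f \<preceq> \<ominus> h \<longleftrightarrow> f \<preceq> h"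
proof -
  have "\<ominus> h \<preceq> h" "h \<preceq> \<ominus> h"
    using assms dom_minus_iff[of h h] dom_minus_iff[of "\<ominus> h" "\<ominus> h"]
    by (auto simp del: dom_minus_iff)
  then show ?thesis using assms by (meson dom_trans a_inv_closed)
qed

lemma dom_add:
  assumes "f \<preceq> h" "g \<preceq> h" "f \<in> carrier L" "g \<in> carrier L" "h \<in> carrier L"
  shows "f \<oplus> g \<preceq> h"
  using dom_diff[of f h "\<ominus> g"] assms by (simp add: minus_eq)

lemma dom_add_cases:
  assumes "f \<in> carrier L" "g \<in> carrier L" shows "f \<oplus> g \<preceq> f \<or> f \<oplus> g \<preceq> g"
  using dom_total[OF assms] dom_add[of f f g] dom_add[of f g g] assms by auto

lemma sdom_add:
  assumes "f \<prec> h" "g \<prec> h" "f \<in> carrier L" "g \<in> carrier L" "h \<in> carrier L"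
  shows "f \<oplus> g \<prec> h"
  using dom_add_cases[of f g] assms by (meson dom_trans a_closed)

lemma sdom_diff:
  assumes "f \<prec> h" "g \<prec> h" "f \<in> carrier L" "g \<in> carrier L" "h \<in> carrier L"
  shows "f \<ominus> g \<prec> h"
  using sdom_add[of h f "\<ominus> g"] assms by (simp add: minus_eq)

text \<open>An error strictly below \<open>w\<close> cannot change the valuation: if
  \<open>f\<close> were strictly below \<open>w\<close> too, then so would be the sum of
  \<open>f\<close> and the error, which is \<open>w\<close> itself.\<close>

lemma dom_of_diff_sdom:
  assumes "w \<ominus> f \<prec> w" "w \<in> carrier L" "f \<in> carrier L"
  shows "f \<preceq> w" "w \<preceq> f"
proof -
  have f: "f = w \<ominus> (w \<ominus> f)" and w: "w = (w \<ominus> f) \<oplus> f" using assms by algebra+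
  show "f \<preceq> w" using assms dom_diff[of w w "w \<ominus> f"] f sdom_imp_dom[of w "w \<ominus> f"] by simp
  show "w \<preceq> f"
  proof (rule ccontr)
    assume "f \<prec> w"
    then have "(w \<ominus> f) \<oplus> f \<prec> w" using assms by (intro sdom_add) auto
    then show False using assms w[symmetric] by simp
  qed
qed

lemma divide_dom_iff:
  assumes "g \<noteq> \<zero>" "f \<in> carrier L" "g \<in> carrier L" "h \<in> carrier L"
  shows "f \<otimes> inv g \<preceq> h \<longleftrightarrow> f \<preceq> h \<otimes> g"
  using dom_cancel_right[of g "f \<otimes> inv g" h] assms by (simp add: m_assoc)

lemma dom_divide_iff:
  assumes "g \<noteq> \<zero>" "f \<in> carrier L" "g \<in> carrier L" "h \<in> carrier L"
  shows "h \<preceq> f \<otimes> inv g \<longleftrightarrow> h \<otimes> g \<preceq> f"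
  using dom_cancel_right[of g h "f \<otimes> inv g"] assms by (simp add: m_assoc)

lemma inv_dom_inv:
  assumes "f \<preceq> g" "f \<noteq> \<zero>" "f \<in> carrier L" "g \<in> carrier L"
  shows "inv g \<preceq> inv f"
proof -
  have g: "g \<noteq> \<zero>" using assms dom_zero by blast
  then have "inv g \<otimes> f \<preceq> \<one>" using divide_dom_iff[of g f \<one>] assms by (simp add: m_comm)
  then show ?thesis using dom_divide_iff[of f \<one> "inv g"] assms g by simp
qed

lemma inv_sdom_one_iff:
  assumes "f \<noteq> \<zero>" "f \<in> carrier L" shows "inv f \<prec> \<one> \<longleftrightarrow> \<one> \<prec> f"
  using divide_dom_iff[of f \<one> \<one>] dom_divide_iff[of f \<one> \<one>] assms by simp

lemma one_sdom_inv_iff: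
  assumes "f \<noteq> \<zero>" "f \<in> carrier L" shows "\<one> \<prec> inv f \<longleftrightarrow> f \<prec> \<one>"
  using divide_dom_iff[of f \<one> \<one>] dom_divide_iff[of f \<one> \<one>] assms by simp

end


section \<open>Asymptotic fields\<close>

lemma (in field) inv_mult:
  assumes "x \<in> carrier R" "y \<in> carrier R" "x \<noteq> \<zero>" "y \<noteq> \<zero>"
  shows "inv (x \<otimes> y) = inv x \<otimes> inv y"
proof -
  have u: "x \<in> Units R" "y \<in> Units R" using assms field_Units by auto
  have "x \<otimes> y \<otimes> (inv x \<otimes> inv y) = x \<otimes> inv x \<otimes> (y \<otimes> inv y)"
    using u assms by (simp add: m_ac del: Units_r_inv Units_l_inv)
  also have "\<dots> = \<one>" using u by simp
  finally show ?thesis using u assms by (intro comm_inv_char) auto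
qed

locale asymptotic_field = field L for L :: "('a, 'b) vdf_scheme" (structure) +
  assumes asymptotic: "asymptotic L"
begin

sublocale valued_field L
  by unfold_locales (use asymptotic in \<open>auto simp: asymptotic_def valued_diff_field_def\<close>)

abbreviation D where "D \<equiv> vder L"
abbreviation ld where "ld \<equiv> ldv L"

lemma derivation: "derivation L"
  using asymptotic by (auto simp: asymptotic_def valued_diff_field_def)

lemma D_closed [simp]: "x \<in> carrier L \<Longrightarrow> D x \<in> carrier L"
  using derivation by (auto simp: derivation_def)

lemma D_add [simp]: "x \<in> carrier L \<Longrightarrow> y \<in> carrier L \<Longrightarrow> D (x \<oplus> y) = D x \<oplus> D y"
  using derivation by (auto simp: derivation_def)

lemma D_mult: "x \<in> carrier L \<Longrightarrow> y \<in> carrier L \<Longrightarrow> D (x \<otimes> y) = D x \<otimes> y \<oplus> x \<otimes> D y"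
  using derivation by (auto simp: derivation_def)

lemma D_zero [simp]: "D \<zero> = \<zero>"
proof -
  have "D \<zero> \<oplus> D \<zero> = D \<zero> \<oplus> \<zero>" using D_add[of \<zero> \<zero>] by simp
  then show ?thesis by (simp del: r_zero)
qed

lemma D_one [simp]: "D \<one> = \<zero>"
proof -
  have "D \<one> \<oplus> D \<one> = D \<one> \<oplus> \<zero>" using D_mult[of \<one> \<one>] by simp
  then show ?thesis by (simp del: r_zero)
qed

lemma D_minus [simp]: "x \<in> carrier L \<Longrightarrow> D (\<ominus> x) = \<ominus> D x"
  using D_add[of x "\<ominus> x"] by (metis D_closed D_zero a_inv_closed minus_equality r_neg a_comm)

lemma D_diff [simp]: "x \<in> carrier L \<Longrightarrow> y \<in> carrier L \<Longrightarrow> D (x \<ominus> y) = D x \<ominus> D y"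
  by (simp add: minus_eq)

lemma D_inv:
  assumes x: "x \<in> carrier L" "x \<noteq> \<zero>"
  shows "D (inv x) = \<ominus> (D x \<otimes> inv x \<otimes> inv x)"
proof -
  define i where "i = inv x"
  have i: "i \<in> carrier L" "x \<otimes> i = \<one>" using x by (auto simp: i_def)
  have "D x \<otimes> i \<oplus> x \<otimes> D i = \<zero>" using D_mult[of x i] x i by simp
  then have "i \<otimes> (D x \<otimes> i \<oplus> x \<otimes> D i) = \<zero>" using i by simp
  moreover have "i \<otimes> (D x \<otimes> i \<oplus> x \<otimes> D i) = D x \<otimes> i \<otimes> i \<oplus> x \<otimes> i \<otimes> D i"
    using x i(1) D_closed[of x] D_closed[of i] by algebra
  ultimately have "D x \<otimes> i \<otimes> i \<oplus> D i = \<zero>" using i x by simp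
  then show ?thesis using x i(1) unfolding i_def[symmetric]
    by (metis D_closed a_comm m_closed minus_equality)
qed

lemma ldv_closed [simp]: "x \<in> carrier L \<Longrightarrow> x \<noteq> \<zero> \<Longrightarrow> ld x \<in> carrier L"
  by (simp add: ldv_def)

lemma D_eq_ldv: "x \<in> carrier L \<Longrightarrow> x \<noteq> \<zero> \<Longrightarrow> D x = x \<otimes> ld x"
  by (simp add: ldv_def m_lcomm[of x])

lemma ldv_mult:
  assumes "x \<in> carrier L" "y \<in> carrier L" "x \<noteq> \<zero>" "y \<noteq> \<zero>"
  shows "ld (x \<otimes> y) = ld x \<oplus> ld y"
proof -
  have e: "x \<otimes> inv x = \<one>" "y \<otimes> inv y = \<one>" "inv x \<in> carrier L" "inv y \<in> carrier L"
    using assms by auto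
  have "ld (x \<otimes> y) = D x \<otimes> inv x \<otimes> (y \<otimes> inv y) \<oplus> D y \<otimes> inv y \<otimes> (x \<otimes> inv x)"
    unfolding ldv_def inv_mult[OF assms] D_mult[OF assms(1,2)]
    using assms e(3,4) D_closed[of x] D_closed[of y] by algebra
  then show ?thesis using assms e unfolding ldv_def by simp
qed

lemma ldv_inv:
  assumes "x \<in> carrier L" "x \<noteq> \<zero>"
  shows "ld (inv x) = \<ominus> ld x"
proof -
  have "ld x \<oplus> ld (inv x) = ld \<one>" using ldv_mult[of x "inv x"] assms by simp
  also have "\<dots> = \<zero>" by (simp add: ldv_def)
  finally show ?thesis using assms by (metis a_comm inv_nonzero(1,2) ldv_closed minus_equality)
qed

lemma prec_iff: "f \<in> carrier L \<Longrightarrow> g \<in> carrier L \<Longrightarrow> prec L f g \<longleftrightarrow> f \<prec> g"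
  using dom_total unfolding prec_def by blast

lemma D_sdom_iff:
  assumes "f \<prec> \<one>" "g \<prec> \<one>" "f \<in> carrier L" "g \<in> carrier L" "f \<noteq> \<zero>" "g \<noteq> \<zero>"
  shows "D f \<prec> D g \<longleftrightarrow> f \<prec> g"
proof -
  have "prec L f g \<longleftrightarrow> prec L (D f) (D g)"
    using asymptotic assms by (auto simp: asymptotic_def prec_iff)
  then show ?thesis using assms by (simp add: prec_iff)
qed

text \<open>If \<open>D f\<close> vanished, so would \<open>D (f \<otimes> f)\<close>. But
  \<open>f \<otimes> f \<prec> f\<close>, so the asymptotic axiom would make
  \<open>D (f \<otimes> f)\<close> strictly smaller than \<open>D f\<close>.\<close>

lemma D_nonzero:
  assumes "f \<prec> \<one>" "f \<in> carrier L" "f \<noteq> \<zero>"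
  shows "D f \<noteq> \<zero>"
proof
  assume "D f = \<zero>"
  moreover have "f \<otimes> f \<prec> f" using dom_cancel_left[of f \<one> f] assms by simp
  moreover have "f \<otimes> f \<prec> \<one>" using assms calculation by (meson m_closed one_closed sdom_trans)
  ultimately show False
    using D_sdom_iff[where f="f \<otimes> f" and g=f] assms integral by (auto simp: D_mult)
qed

lemma D_sdom:
  assumes "f \<prec> g" "g \<prec> \<one>" "f \<in> carrier L" "g \<in> carrier L"
  shows "D f \<prec> D g"
proof (cases "f = \<zero>")
  case True
  then show ?thesis using assms D_nonzero[of g] by (auto simp: zero_sdom_iff)
next
  case False
  moreover have "g \<noteq> \<zero>" "f \<prec> \<one>" using assms by (auto, meson dom_total dom_trans one_closed)
  ultimately show ?thesis using D_sdom_iff assms by blast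
qed

lemma D_dom:
  assumes "f \<preceq> g" "g \<prec> \<one>" "f \<in> carrier L" "g \<in> carrier L"
  shows "D f \<preceq> D g"
proof (rule ccontr)
  assume a: "D g \<prec> D f"
  have f: "f \<prec> \<one>" using assms by (meson dom_trans one_closed)
  have "f \<noteq> \<zero>" using a assms by auto
  moreover have "g \<noteq> \<zero>" using assms dom_zero calculation by auto
  ultimately show False using D_sdom_iff[of g f] f a assms by auto
qed

text \<open>Both \<open>D (f \<otimes> g)\<close> and \<open>f \<otimes> D g\<close> lie strictly
  below \<open>D g\<close>, and their difference is \<open>D f \<otimes> g\<close>; division by
  \<open>g\<close> gives the claim. This bound is what makes the error terms of the later
  approximations infinitesimal.\<close>

lemma D_sdom_ldv:
  assumes "f \<prec> \<one>" "g \<prec> \<one>" "f \<in> carrier L" "g \<in> carrier L" "g \<noteq> \<zero>"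
  shows "D f \<prec> ld g"
proof -
  have Dg: "D g \<noteq> \<zero>" using D_nonzero assms by blast
  have "f \<otimes> g \<prec> g" using dom_cancel_right[of g \<one> f] assms by simp
  then have "D (f \<otimes> g) \<prec> D g" using assms by (intro D_sdom) auto
  moreover have "f \<otimes> D g \<prec> D g" using dom_cancel_right[of "D g" \<one> f] Dg assms by simp
  ultimately have "D (f \<otimes> g) \<ominus> f \<otimes> D g \<prec> D g" using assms by (intro sdom_diff) auto
  moreover have "D (f \<otimes> g) \<ominus> f \<otimes> D g = D f \<otimes> g"
    unfolding D_mult[OF assms(3,4)] using assms D_closed[of f] D_closed[of g] by algebra
  ultimately show ?thesis unfolding ldv_def using divide_dom_iff[of g] assms by simp
qed

lemma D_sdom_ldv_large:
  assumes "f \<prec> \<one>" "\<one> \<prec> g" "f \<in> carrier L" "g \<in> carrier L"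
  shows "D f \<prec> ld g"
proof -
  have g: "g \<noteq> \<zero>" using assms(2,4) by auto
  then have "inv g \<prec> \<one>" using inv_sdom_one_iff assms by blast
  then have "D f \<prec> ld (inv g)" using g assms by (intro D_sdom_ldv) auto
  then show ?thesis using g assms by (simp add: ldv_inv)
qed

text \<open>With \<open>f = \<zero>\<close>, the two preceding bounds place zero strictly below
  \<open>ld g\<close>.\<close>

lemma ldv_nonzero:
  assumes "g \<prec> \<one> \<or> \<one> \<prec> g" "g \<in> carrier L" "g \<noteq> \<zero>"
  shows "ld g \<noteq> \<zero>"
  using D_sdom_ldv[where f=\<zero> and g=g] D_sdom_ldv_large[where f=\<zero> and g=g] assms
  by (auto simp: zero_sdom_iff)

lemma const_sdom_one: "c \<prec> \<one> \<Longrightarrow> D c = \<zero> \<Longrightarrow> c \<in> carrier L \<Longrightarrow> c = \<zero>"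
  using D_nonzero by blast

text \<open>The inverse of a constant larger than 1 would be a nonzero infinitesimal constant, which
  \<open>const_sdom_one\<close> excludes.\<close>

lemma const_dom_one:
  assumes "D c = \<zero>" "c \<in> carrier L" shows "c \<preceq> \<one>"
proof (rule ccontr)
  assume c: "\<one> \<prec> c"
  then have "c \<noteq> \<zero>" by auto
  then show False using c const_sdom_one[of "inv c"] inv_sdom_one_iff[of c] assms
    by (auto simp: D_inv)
qed

end

locale H_asymptotic_field = asymptotic_field +
  assumes H_type: "H_type L"
begin

text \<open>The H-type axiom speaks only of \<open>f \<prec> g\<close>. For equal valuations the
  asymptotic axiom compares the derivatives, and the inverses are compared directly.\<close>

lemma ldv_antimono:
  assumes "f \<preceq> g" "g \<prec> \<one>" "f \<in> carrier L" "g \<in> carrier L" "f \<noteq> \<zero>"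
  shows "ld g \<preceq> ld f"
proof (cases "g \<preceq> f")
  case True
  have g: "g \<noteq> \<zero>" using assms dom_zero by auto
  have "f \<prec> \<one>" using assms by (meson dom_trans one_closed)
  then have "D g \<preceq> D f" using D_dom True assms by blast
  moreover have "inv g \<preceq> inv f" using inv_dom_inv assms by blast
  ultimately show ?thesis unfolding ldv_def using g assms by (intro dom_mult) auto
next
  case False
  then have "g \<noteq> \<zero>" using assms by auto
  then show ?thesis using H_type False assms by (auto simp: H_type_def prec_iff preceq_def)
qed

end


section \<open>Integration up to a uniform relative error\<close>

text \<open>\<open>F\<close> will be the image of \<open>K\<close> in \<open>L\<close>, described
  entirely with the operations of \<open>L\<close>. In \<open>ungrounded\<close>, infinitesimals
  stand for all elements of nonzero valuation, since inversion only changes the sign of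
  \<open>ld\<close>.\<close>

locale lambda_free_subfield = H_asymptotic_field +
  fixes F
  assumes subfield: "subfield F L"
    and D_in: "x \<in> F \<Longrightarrow> D x \<in> F"
    and lambda: "s \<in> F \<Longrightarrow> \<exists>g\<in>F. \<one> \<prec> g \<and> ld g \<preceq> s \<ominus> ld (ld g)"
    and ungrounded: "\<lbrakk>g \<in> F; g \<noteq> \<zero>; g \<prec> \<one>\<rbrakk> \<Longrightarrow> \<exists>h\<in>F. h \<noteq> \<zero> \<and> h \<prec> \<one> \<and> ld h \<prec> ld g"
begin

lemma F_carrier [simp]: "x \<in> F \<Longrightarrow> x \<in> carrier L"
  using subfieldE(3)[OF subfield] by blast

lemma F_zero [simp]: "\<zero> \<in> F" and F_one [simp]: "\<one> \<in> F"
  and F_minus [simp]: "x \<in> F \<Longrightarrow> \<ominus> x \<in> F"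
  and F_add [simp]: "x \<in> F \<Longrightarrow> y \<in> F \<Longrightarrow> x \<oplus> y \<in> F"
  and F_mult [simp]: "x \<in> F \<Longrightarrow> y \<in> F \<Longrightarrow> x \<otimes> y \<in> F"
  and F_diff [simp]: "x \<in> F \<Longrightarrow> y \<in> F \<Longrightarrow> x \<ominus> y \<in> F"
  using subringE[OF subfieldE(1)[OF subfield]] by (auto simp: minus_eq)

lemma F_inv [simp]: "x \<in> F \<Longrightarrow> x \<noteq> \<zero> \<Longrightarrow> inv x \<in> F"
  using subfield_m_inv(1)[OF subfield, of x] by blast

lemma F_ldv [simp]: "x \<in> F \<Longrightarrow> x \<noteq> \<zero> \<Longrightarrow> ld x \<in> F"
  by (simp add: ldv_def D_in)

lemma ex_common_bound:
  assumes "a \<in> F" "b \<in> F" "a \<prec> \<one>" "b \<prec> \<one>"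
  shows "\<exists>c\<in>F. c \<prec> \<one> \<and> a \<preceq> c \<and> b \<preceq> c"
  using assms dom_total[of a b] dom_refl F_carrier by meson

text \<open>If \<open>\<epsilon>\<close> exceeded all infinitesimals of \<open>F\<close>, then the logarithmic derivative of \<open>\<epsilon>'\<close> would
  contradict \<open>\<lambda>\<close>-freeness of \<open>F\<close>.\<close>
lemma ex_infinitesimal_bound:
  assumes e: "\<epsilon> \<in> carrier L" "\<epsilon> \<noteq> \<zero>" "\<epsilon> \<prec> \<one>" and De: "D \<epsilon> \<in> F"
  shows "\<exists>\<theta>\<in>F. \<theta> \<noteq> \<zero> \<and> \<theta> \<prec> \<one> \<and> \<epsilon> \<preceq> \<theta>"
proof (rule ccontr)
  assume "\<not> ?thesis"
  then have large: "m \<prec> \<epsilon>" if "m \<in> F" "m \<prec> \<one>" for m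
    using that e by (cases "m = \<zero>") (auto simp: zero_sdom_iff)
  define s where "s = D \<epsilon>"
  have s: "s \<in> F" "s \<noteq> \<zero>" using De D_nonzero e by (auto simp: s_def)
  obtain g where g: "g \<in> F" "\<one> \<prec> g" "ld g \<preceq> ld s \<ominus> ld (ld g)"
    using lambda[of "ld s"] s by auto
  have g0: "g \<noteq> \<zero>" using g(2) by auto
  have ldg: "ld g \<in> F" "ld g \<noteq> \<zero>" using g g0 ldv_nonzero[of g] by auto
  \<comment> \<open>This \<open>m\<close> is chosen so that \<open>ld m\<close> is the difference
    \<open>ld s \<ominus> ld (ld g)\<close> from the choice of \<open>g\<close>, while
    \<open>s/m\<close> is \<open>ld g\<close>. Being an infinitesimal of \<open>F\<close>, it lies
    below \<epsilon>; hence \<open>D m \<prec> s\<close>, and division by \<open>m\<close>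
    contradicts that choice.\<close>
  define m where "m = s \<otimes> inv (ld g)"
  have m: "m \<in> F" "m \<noteq> \<zero>" using s ldg by (auto simp: m_def integral_iff)
  have "s \<prec> ld g" unfolding s_def using e g by (intro D_sdom_ldv_large) auto
  then have "m \<prec> \<one>" using dom_divide_iff[of "ld g" s \<one>] s ldg by (simp add: m_def)
  then have "D m \<prec> s" unfolding s_def using large[OF m(1)] e m by (intro D_sdom) auto
  then have "ld m \<prec> s \<otimes> inv m"
    unfolding ldv_def using dom_cancel_right[of "inv m" s "D m"] m s by simp
  moreover have "s \<otimes> inv m = ld g"
  proof -
    have "s = m \<otimes> ld g" using s ldg by (simp add: m_def m_assoc)
    then have "s \<otimes> inv m = (m \<otimes> ld g) \<otimes> inv m" by simp
    also have "\<dots> = (m \<otimes> inv m) \<otimes> ld g" using m ldg by (simp add: m_ac del: inv_nonzero)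
    finally show ?thesis using m ldg by simp
  qed
  moreover have "ld m = ld s \<ominus> ld (ld g)"
    using s ldg by (simp add: m_def ldv_mult ldv_inv minus_eq)
  ultimately show False using g by simp
qed

text \<open>As \<open>ld\<close> reverses dominance on infinitesimals, an \<open>h\<close> with
  \<open>ld h \<prec> ld \<theta>\<close> cannot satisfy
  \<open>h \<preceq> \<theta>\<close>.\<close>

lemma ex_between:
  assumes "\<theta> \<in> F" "\<theta> \<noteq> \<zero>" "\<theta> \<prec> \<one>"
  shows "\<exists>h\<in>F. \<theta> \<prec> h \<and> h \<prec> \<one>"
proof -
  obtain h where h: "h \<in> F" "h \<noteq> \<zero>" "h \<prec> \<one>" "ld h \<prec> ld \<theta>" using ungrounded[OF assms] by auto
  then have "\<theta> \<prec> h" using ldv_antimono[of h \<theta>] assms by auto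
  then show ?thesis using h by auto
qed

text \<open>The bound \<open>\<kappa>\<close> must not depend on \<open>w\<close>.  From \<open>w = w'/w\<^sup>\<dagger>\<close>, the approximation \<open>h \<sim> w'\<close>
  gives the approximation \<open>h/(h/\<phi>)\<^sup>\<dagger>\<close> of \<open>w\<close>, where passing from \<open>h\<^sup>\<dagger>\<close> to \<open>(h/\<phi>)\<^sup>\<dagger>\<close>
  with \<open>\<phi> \<prec> \<omega>\<^sup>\<dagger> \<preceq> w\<^sup>\<dagger>\<close> in \<open>\<Psi>\<close> ensures that \<open>(w\<^sup>\<dagger>/\<phi>)\<^sup>\<dagger>\<close> is negligible against \<open>w\<^sup>\<dagger>\<close>.\<close>
lemma ex_uniform_integral_approx:
  assumes th: "\<theta> \<in> F" "\<theta> \<noteq> \<zero>" "\<theta> \<prec> \<one>" and om: "\<omega> \<in> F" "\<omega> \<noteq> \<zero>" "\<omega> \<prec> \<one>"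
  obtains \<kappa> where "\<kappa> \<in> F" "\<kappa> \<noteq> \<zero>" "\<kappa> \<prec> \<one>"
    "\<And>w h. \<lbrakk>w \<in> carrier L; w \<noteq> \<zero>; w \<preceq> \<omega>; h \<in> F; D w \<ominus> h \<preceq> \<theta> \<otimes> D w\<rbrakk>
       \<Longrightarrow> \<exists>f\<in>F. w \<ominus> f \<preceq> \<kappa> \<otimes> w"
proof -
  obtain g where g: "g \<in> F" "g \<noteq> \<zero>" "g \<prec> \<one>" "ld g \<prec> ld \<omega>" using ungrounded[OF om] by auto
  define \<phi> where "\<phi> = ld g"
  have phi: "\<phi> \<in> F" "\<phi> \<noteq> \<zero>" using g ldv_nonzero[of g] by (auto simp: \<phi>_def)
  have lom: "ld \<omega> \<in> F" "ld \<omega> \<noteq> \<zero>" using om ldv_nonzero[of \<omega>] by auto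
  define p0 where "p0 = ld \<omega> \<otimes> inv \<phi>"
  have p0: "p0 \<in> F" "p0 \<noteq> \<zero>" using lom phi by (auto simp: p0_def integral_iff)
  have "\<one> \<prec> p0" using divide_dom_iff[of \<phi> "ld \<omega>" \<one>] phi lom g by (simp add: p0_def \<phi>_def)
  then have ip0: "inv p0 \<prec> \<one>" using inv_sdom_one_iff p0 by simp
  \<comment> \<open>Relative to \<open>q = ld w\<close>, the elements \<open>\<kappa>1\<close> and
    \<open>\<kappa>2\<close> will bound the two errors \<open>ld p\<close> and \<open>ld r\<close>
    below. Each is the derivative of an infinitesimal divided by a logarithmic derivative, hence
    infinitesimal, and neither involves \<open>w\<close> or \<open>h\<close>.\<close>
  define \<kappa>1 where "\<kappa>1 = D (inv p0) \<otimes> inv \<phi>"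
  define \<kappa>2 where "\<kappa>2 = D \<theta> \<otimes> inv (ld \<omega>)"
  have k1: "\<kappa>1 \<in> F" using p0 phi by (simp add: \<kappa>1_def D_in)
  have "D (inv p0) \<prec> \<phi>" unfolding \<phi>_def using ip0 p0 g by (intro D_sdom_ldv) auto
  then have k1': "\<kappa>1 \<prec> \<one>" using dom_divide_iff[of \<phi> "D (inv p0)" \<one>] phi p0 by (simp add: \<kappa>1_def)
  have k2: "\<kappa>2 \<in> F" using th lom by (simp add: \<kappa>2_def D_in)
  have "D \<theta> \<prec> ld \<omega>" using th om by (intro D_sdom_ldv) auto
  then have k2': "\<kappa>2 \<prec> \<one>" using dom_divide_iff[of "ld \<omega>" "D \<theta>" \<one>] lom th by (simp add: \<kappa>2_def)
  obtain c where c: "c \<in> F" "c \<prec> \<one>" "\<kappa>1 \<preceq> c" "\<kappa>2 \<preceq> c"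
    using ex_common_bound[OF k1 k2 k1' k2'] by auto
  obtain \<kappa> where k: "\<kappa> \<in> F" "\<kappa> \<prec> \<one>" "\<theta> \<preceq> \<kappa>" "c \<preceq> \<kappa>"
    using ex_common_bound[OF th(1) c(1) th(3) c(2)] by auto
  have k12: "\<kappa>1 \<preceq> \<kappa>" "\<kappa>2 \<preceq> \<kappa>" using k c k1 k2 by (meson dom_trans F_carrier)+
  have k0: "\<kappa> \<noteq> \<zero>" using k(3) th dom_zero by auto
  show thesis
  proof (rule that[OF k(1) k0 k(2)])
    fix w h
    assume w: "w \<in> carrier L" "w \<noteq> \<zero>" "w \<preceq> \<omega>" and h: "h \<in> F" "D w \<ominus> h \<preceq> \<theta> \<otimes> D w"
    have w1: "w \<prec> \<one>" using w om by (meson dom_trans one_closed F_carrier)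
    define q where "q = ld w"
    have q: "q \<in> carrier L" "q \<noteq> \<zero>" using w w1 ldv_nonzero[of w] by (auto simp: q_def)
    have Dw: "D w = w \<otimes> q" "D w \<noteq> \<zero>" using D_eq_ldv D_nonzero w w1 by (auto simp: q_def)
    have omq: "ld \<omega> \<preceq> q" unfolding q_def using w om by (intro ldv_antimono) auto
    \<comment> \<open>\<open>r\<close> is the ratio of the approximation \<open>h\<close> to
      \<open>D w\<close>; it differs from 1 by at most \<theta>.\<close>
    define r where "r = h \<otimes> inv (D w)"
    have r: "r \<in> carrier L" using h Dw(2) w by (simp add: r_def)
    have hr: "h = D w \<otimes> r" using h Dw(2) w by (simp add: r_def m_lcomm[of "D w"])
    have "D w \<otimes> (\<one> \<ominus> r) \<preceq> D w \<otimes> \<theta>"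
    proof -
      have "D w \<otimes> (\<one> \<ominus> r) = D w \<ominus> h" unfolding hr using r D_closed[OF w(1)] by algebra
      then show ?thesis using h w th by (simp add: m_comm)
    qed
    then have r1: "\<one> \<ominus> r \<preceq> \<theta>" using dom_cancel_left[OF Dw(2)] w r th by simp
    then have r1': "\<one> \<ominus> r \<prec> \<one>" using th r by (meson dom_trans one_closed F_carrier minus_closed)
    then have r2: "\<one> \<preceq> r" using dom_of_diff_sdom[of \<one> r] r by simp
    then have r0: "r \<noteq> \<zero>" by auto
    define p where "p = q \<otimes> inv \<phi>"
    have p: "p \<in> carrier L" "p \<noteq> \<zero>" using q phi by (auto simp: p_def integral_iff)
    have p0p: "p0 \<preceq> p" unfolding p0_def p_def using omq lom q phi by (intro dom_mult_right) auto
    \<comment> \<open>This factorization splits the logarithmic derivative of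
      \<open>h/\<phi>\<close> into the desired \<open>q = ld w\<close> and the errors
      \<open>ld p\<close> and \<open>ld r\<close>.\<close>
    have "h \<otimes> inv \<phi> = w \<otimes> (p \<otimes> r)"
      unfolding hr Dw(1) p_def using w q r phi F_carrier[OF F_inv[OF phi]] by algebra
    then have ldk: "ld (h \<otimes> inv \<phi>) = q \<oplus> (ld p \<oplus> ld r)"
      using w p r r0 by (simp add: ldv_mult q_def integral_iff)
    have h0: "h \<noteq> \<zero>" using hr Dw(2) w r r0 by (simp add: integral_iff)
    have kq: "\<kappa> \<otimes> q \<in> carrier L" using k q by simp
    \<comment> \<open>Since \<open>p\<close> is at least as large as \<open>p0\<close>, its inverse
      is an infinitesimal dominated by \<open>inv p0\<close>. Comparing the derivatives of the
      inverses and multiplying by \<open>p\<close> gives the bound.\<close>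
    have ldp: "ld p \<preceq> \<kappa> \<otimes> q"
    proof -
      have "D (inv p) \<preceq> D (inv p0)"
        using inv_dom_inv[OF p0p] p0 p ip0 by (intro D_dom) auto
      moreover have "D (inv p) = \<ominus> (ld p \<otimes> inv p)" using p by (simp add: D_inv ldv_def)
      ultimately have "ld p \<otimes> inv p \<preceq> D (inv p0)" using p p0 by simp
      then have "ld p \<preceq> D (inv p0) \<otimes> p" using divide_dom_iff[of p] p p0 by simp
      also have "D (inv p0) \<otimes> p = \<kappa>1 \<otimes> q"
        unfolding \<kappa>1_def p_def using q p0 phi by (simp add: m_ac)
      also have "\<kappa>1 \<otimes> q \<preceq> \<kappa> \<otimes> q" using k12 k1 k q by (intro dom_mult_right) auto
      finally show ?thesis using k1 k p p0 q by simp
    qed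
    \<comment> \<open>Up to sign \<open>D r\<close> is the derivative of
      \<open>\<one> \<ominus> r\<close>, hence dominated by \<open>D \<theta>\<close>; division by
      \<open>r\<close> does no harm because \<open>\<one> \<preceq> r\<close>.\<close>
    have ldr: "ld r \<preceq> \<kappa> \<otimes> q"
    proof -
      have "D (\<one> \<ominus> r) \<preceq> D \<theta>" using r1 r th by (intro D_dom) auto
      then have Dr: "D r \<preceq> D \<theta>" using r th by (simp add: minus_eq)
      have "inv r \<preceq> \<one>" using divide_dom_iff[of r \<one> \<one>] r r0 r2 by simp
      then have "ld r \<preceq> D \<theta>" unfolding ldv_def using Dr r r0 th by (intro dom_mult_le) auto
      also have "D \<theta> = \<kappa>2 \<otimes> ld \<omega>" unfolding \<kappa>2_def using th lom by (simp add: m_assoc)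
      also have "\<kappa>2 \<otimes> ld \<omega> \<preceq> \<kappa> \<otimes> q" using k12 omq k2 lom k q by (intro dom_mult) auto
      finally show ?thesis using r r0 th kq k2 lom by simp
    qed
    define l where "l = ld (h \<otimes> inv \<phi>)"
    have l: "l \<in> F" using h h0 phi by (simp add: l_def integral_iff)
    have "l \<ominus> q = ld p \<oplus> ld r"
      unfolding l_def ldk using q ldv_closed[OF p] ldv_closed[OF r r0] by algebra
    then have lq: "l \<ominus> q \<preceq> \<kappa> \<otimes> q" using ldp ldr p r r0 kq by (simp add: dom_add)
    have "\<kappa> \<otimes> q \<prec> q" using dom_cancel_right[of q \<one> \<kappa>] q k by simp
    then have "l \<ominus> q \<prec> q" using lq l q kq by (meson dom_trans minus_closed F_carrier)
    have "q \<preceq> l \<ominus> q \<longleftrightarrow> q \<preceq> q \<ominus> l"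
      using minus_dom_iff[of q "l \<ominus> q"] q l by (simp add: minus_eq minus_add a_comm del: minus_dom_iff)
    then have "q \<ominus> l \<prec> q" using \<open>l \<ominus> q \<prec> q\<close> by blast
    then have ql: "q \<preceq> l" using dom_of_diff_sdom(2)[of q l] q F_carrier[OF l] by blast
    then have l0: "l \<noteq> \<zero>" using q dom_zero by auto
    define f where "f = h \<otimes> inv l"
    have f: "f \<in> F" using h l l0 by (simp add: f_def)
    have kwl: "\<kappa> \<otimes> (w \<otimes> l) \<in> carrier L" using k w l by simp
    \<comment> \<open>The error of \<open>f = h/l\<close> has two sources: \<open>l\<close> in place
      of \<open>ld w\<close>, and \<open>h\<close> in place of \<open>D w\<close>. Each is bounded
      by \<open>\<kappa> \<otimes> (w \<otimes> l)\<close>.\<close>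
    have "(w \<ominus> f) \<otimes> l = w \<otimes> (l \<ominus> q) \<oplus> (D w \<ominus> h)"
    proof -
      have "f \<otimes> l = h" using h l l0 by (simp add: f_def m_assoc)
      moreover have "(w \<ominus> f) \<otimes> l = w \<otimes> l \<ominus> f \<otimes> l" using w F_carrier[OF f] F_carrier[OF l] by algebra
      ultimately have "(w \<ominus> f) \<otimes> l = w \<otimes> l \<ominus> h" by simp
      also have "\<dots> = w \<otimes> (l \<ominus> q) \<oplus> (w \<otimes> q \<ominus> h)"
        using w q F_carrier[OF h(1)] F_carrier[OF l] by algebra
      finally show ?thesis unfolding Dw(1) .
    qed
    moreover have "w \<otimes> (l \<ominus> q) \<preceq> \<kappa> \<otimes> (w \<otimes> l)"
    proof -
      have "l \<ominus> q \<preceq> \<kappa> \<otimes> l"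
        using lq ql dom_cancel_left[of \<kappa> q l] k k0 q l kq by (meson dom_trans minus_closed F_carrier m_closed)
      then have "w \<otimes> (l \<ominus> q) \<preceq> w \<otimes> (\<kappa> \<otimes> l)" using w l q k by (simp add: dom_cancel_left)
      then show ?thesis using w l k by (simp add: m_lcomm)
    qed
    moreover have "D w \<ominus> h \<preceq> \<kappa> \<otimes> (w \<otimes> l)"
    proof -
      have "w \<otimes> q \<preceq> w \<otimes> l" using ql w q l by (simp add: dom_cancel_left)
      from dom_mult[OF k(3) this] have "\<theta> \<otimes> D w \<preceq> \<kappa> \<otimes> (w \<otimes> l)"
        unfolding Dw(1) using k th w l q by simp
      then show ?thesis using h(2) kwl th w h(1) by (meson dom_trans D_closed minus_closed F_carrier m_closed)
    qed
    ultimately have "(w \<ominus> f) \<otimes> l \<preceq> \<kappa> \<otimes> (w \<otimes> l)" using w l q h k kwl by (simp add: dom_add)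
    then have "(w \<ominus> f) \<otimes> l \<preceq> (\<kappa> \<otimes> w) \<otimes> l" using w l k by (simp add: m_assoc)
    then have "w \<ominus> f \<preceq> \<kappa> \<otimes> w" using dom_cancel_right[of l] w l l0 k f by simp
    then show "\<exists>f\<in>F. w \<ominus> f \<preceq> \<kappa> \<otimes> w" using f by blast
  qed
qed

end


section \<open>Adjoining constants\<close>

context lambda_free_subfield begin

definition consts_near :: "'a set" where
  "consts_near = {c \<in> carrier L. D c = \<zero> \<and> (\<exists>u\<in>F. c \<ominus> u \<prec> \<one>)}"

text \<open>Starting from \<open>F\<close> puts 1 among the generators, so every span contains
  \<open>F\<close>. Lists allow induction on the number of constants, and concatenation brings two
  elements into a common span.\<close>

primrec const_span :: "'a list \<Rightarrow> 'a set" where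
  "const_span [] = F"
| "const_span (c # cs) = {x \<oplus> f \<otimes> c | x f. x \<in> const_span cs \<and> f \<in> F}"

lemma consts_nearD [simp]: "c \<in> consts_near \<Longrightarrow> c \<in> carrier L" "c \<in> consts_near \<Longrightarrow> D c = \<zero>"
  and ex_near: "c \<in> consts_near \<Longrightarrow> \<exists>u\<in>F. c \<ominus> u \<prec> \<one>"
  by (simp_all add: consts_near_def)

lemma const_span_carrier:
  "set cs \<subseteq> consts_near \<Longrightarrow> x \<in> const_span cs \<Longrightarrow> x \<in> carrier L"
  by (induction cs arbitrary: x) auto

lemma const_span_Cons:
  "x \<in> const_span cs \<Longrightarrow> c \<in> carrier L \<Longrightarrow> x \<in> carrier L \<Longrightarrow> x \<in> const_span (c # cs)"
  using F_zero by (simp, metis l_null r_zero)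

lemma const_span_append_left:
  "set cs \<subseteq> consts_near \<Longrightarrow> set ds \<subseteq> consts_near \<Longrightarrow> x \<in> const_span ds \<Longrightarrow> x \<in> const_span (cs @ ds)"
proof (induction cs)
  case (Cons c cs)
  then show ?case using const_span_carrier[of "ds"] const_span_Cons[of x "cs @ ds" c] by simp
qed simp

lemma F_subset_const_span:
  "set ds \<subseteq> consts_near \<Longrightarrow> x \<in> F \<Longrightarrow> x \<in> const_span ds"
  using const_span_append_left[of ds "[]" x] by simp

lemma const_span_append_right:
  "set cs \<subseteq> consts_near \<Longrightarrow> set ds \<subseteq> consts_near \<Longrightarrow> x \<in> const_span cs \<Longrightarrow> x \<in> const_span (cs @ ds)"
proof (induction cs arbitrary: x)
  case Nil
  then show ?case using F_subset_const_span by simp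
next
  case (Cons c cs)
  then show ?case by auto
qed

lemma const_span_add:
  "set cs \<subseteq> consts_near \<Longrightarrow> x \<in> const_span cs \<Longrightarrow> y \<in> const_span cs \<Longrightarrow> x \<oplus> y \<in> const_span cs"
proof (induction cs arbitrary: x y)
  case (Cons c cs)
  obtain x' f y' g where e: "x = x' \<oplus> f \<otimes> c" "y = y' \<oplus> g \<otimes> c" "x' \<in> const_span cs"
    "y' \<in> const_span cs" "f \<in> F" "g \<in> F" using Cons.prems by auto
  have "x \<oplus> y = (x' \<oplus> y') \<oplus> (f \<oplus> g) \<otimes> c"
    using Cons.prems(1) const_span_carrier[of cs x'] const_span_carrier[of cs y'] e(3-4)
      F_carrier[OF e(5)] F_carrier[OF e(6)] consts_nearD(1)[of c] unfolding e(1,2) list.set insert_subset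
    by algebra
  moreover have "x' \<oplus> y' \<in> const_span cs" "f \<oplus> g \<in> F" using Cons e by auto
  ultimately show ?case by auto
qed simp

lemma const_span_scale:
  "set cs \<subseteq> consts_near \<Longrightarrow> x \<in> const_span cs \<Longrightarrow> f \<in> F \<Longrightarrow> f \<otimes> x \<in> const_span cs"
proof (induction cs arbitrary: x)
  case (Cons c cs)
  obtain x' g where e: "x = x' \<oplus> g \<otimes> c" "x' \<in> const_span cs" "g \<in> F" using Cons.prems by auto
  have "f \<otimes> x = f \<otimes> x' \<oplus> (f \<otimes> g) \<otimes> c"
    using Cons.prems(1) const_span_carrier[of cs x'] e(2)
      F_carrier[OF e(3)] F_carrier[OF Cons.prems(3)] consts_nearD(1)[of c]
    unfolding e(1) list.set insert_subset by algebra
  moreover have "f \<otimes> x' \<in> const_span cs" "f \<otimes> g \<in> F" using Cons e by auto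
  ultimately show ?case by auto
qed simp

lemma const_span_diff:
  assumes "set cs \<subseteq> consts_near" "x \<in> const_span cs" "y \<in> const_span cs"
  shows "x \<ominus> y \<in> const_span cs"
proof -
  have "x \<ominus> y = x \<oplus> (\<ominus> \<one>) \<otimes> y"
    using const_span_carrier[OF assms(1,2)] const_span_carrier[OF assms(1,3)] by algebra
  then show ?thesis using assms by (simp add: const_span_add const_span_scale)
qed

text \<open>The listed generators are constants, so the derivation acts on the coefficients
  alone.\<close>

lemma const_span_D: "set cs \<subseteq> consts_near \<Longrightarrow> x \<in> const_span cs \<Longrightarrow> D x \<in> const_span cs"
proof (induction cs arbitrary: x)
  case Nil
  then show ?case by (simp add: D_in)
next
  case (Cons c cs)
  obtain x' g where e: "x = x' \<oplus> g \<otimes> c" "x' \<in> const_span cs" "g \<in> F" using Cons.prems by auto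
  have "x' \<in> carrier L" using const_span_carrier[OF _ e(2)] Cons.prems by simp
  then have "D x = D x' \<oplus> D g \<otimes> c" using Cons.prems e by (simp add: D_mult)
  moreover have "D x' \<in> const_span cs" "D g \<in> F" using Cons e D_in by auto
  ultimately show ?case by auto
qed

text \<open>One relative precision has to serve all of \<open>W\<close>; this uniformity is what
  later allows approximations of quotients to be improved repeatedly. For \<open>w = \<zero>\<close>
  the condition forces \<open>f = \<zero>\<close>.\<close>

definition approximable :: "'a \<Rightarrow> 'a set \<Rightarrow> bool" where
  "approximable \<kappa> W \<longleftrightarrow> (\<forall>w\<in>W. \<exists>f\<in>F. w \<ominus> f \<preceq> \<kappa> \<otimes> w)"

lemma approximable_mono:
  assumes "approximable \<kappa> W" "\<kappa> \<preceq> \<mu>" "\<kappa> \<in> F" "\<mu> \<in> F" "W \<subseteq> carrier L"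
  shows "approximable \<mu> W"
  unfolding approximable_def
proof
  fix w assume w: "w \<in> W"
  then obtain f where f: "f \<in> F" "w \<ominus> f \<preceq> \<kappa> \<otimes> w" using assms by (auto simp: approximable_def)
  have "w \<in> carrier L" using w assms by auto
  moreover then have "\<kappa> \<otimes> w \<preceq> \<mu> \<otimes> w" using assms by (simp add: dom_mult_right)
  ultimately have "w \<ominus> f \<preceq> \<mu> \<otimes> w"
    using f assms by (meson dom_trans F_carrier m_closed minus_closed)
  then show "\<exists>f\<in>F. w \<ominus> f \<preceq> \<mu> \<otimes> w" using f by blast
qed

text \<open>An element \<open>y + c\<close> either dominates \<open>\<theta>/h\<close> times its summands, and then the approximations
  of the summands have relative error at most \<open>h\<close>, or is itself \<open>\<preceq> \<theta>/h\<close>.\<close>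
lemma const_span_approximable_step:
  assumes cs: "set (c # cs) \<subseteq> consts_near"
    and th: "\<theta> \<in> F" "\<theta> \<noteq> \<zero>" "\<theta> \<prec> \<one>" "approximable \<theta> (const_span cs)"
    and u: "u \<in> F" "c \<ominus> u \<preceq> \<theta>"
  shows "\<exists>\<kappa>\<in>F. \<kappa> \<noteq> \<zero> \<and> \<kappa> \<prec> \<one> \<and> approximable \<kappa> (const_span (c # cs))"
proof -
  have c: "c \<in> carrier L" "D c = \<zero>" using cs by auto
  obtain h where h: "h \<in> F" "\<theta> \<prec> h" "h \<prec> \<one>" using ex_between[OF th(1-3)] by auto
  have h0: "h \<noteq> \<zero>" using h th by auto
  define \<omega> where "\<omega> = \<theta> \<otimes> inv h"
  have om: "\<omega> \<in> F" "\<omega> \<noteq> \<zero>" "\<omega> \<prec> \<one>"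
    using th h h0 dom_divide_iff[of h \<theta> \<one>] by (auto simp: \<omega>_def integral_iff)
  obtain \<kappa> where k: "\<kappa> \<in> F" "\<kappa> \<noteq> \<zero>" "\<kappa> \<prec> \<one>"
    "\<And>w g. \<lbrakk>w \<in> carrier L; w \<noteq> \<zero>; w \<preceq> \<omega>; g \<in> F; D w \<ominus> g \<preceq> \<theta> \<otimes> D w\<rbrakk>
       \<Longrightarrow> \<exists>f\<in>F. w \<ominus> f \<preceq> \<kappa> \<otimes> w"
    using ex_uniform_integral_approx[OF th(1-3) om] by metis
  obtain \<mu> where m: "\<mu> \<in> F" "\<mu> \<prec> \<one>" "h \<preceq> \<mu>" "\<kappa> \<preceq> \<mu>"
    using ex_common_bound[OF h(1) k(1) h(3) k(3)] by auto
  have m0: "\<mu> \<noteq> \<zero>" using m h h0 dom_zero by auto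
  have le_mu: "\<theta> \<preceq> \<mu>" using h(2) m h(1) th(1) by (meson dom_total dom_trans F_carrier)
  \<comment> \<open>After division by the coefficient of \<open>c\<close>, it suffices to treat
    elements in which that coefficient is 1.\<close>
  have monic: "\<exists>b\<in>F. v \<ominus> b \<preceq> \<mu> \<otimes> v" if y: "y \<in> const_span cs" and v: "v = y \<oplus> c" for v y
  proof -
    have yc: "y \<in> carrier L" and vc: "v \<in> carrier L" using const_span_carrier cs y v c by auto
    obtain g where g: "g \<in> F" "y \<ominus> g \<preceq> \<theta> \<otimes> y" using th(4) y by (auto simp: approximable_def)
    have dom_mu: "x \<preceq> \<mu> \<otimes> v" if "x \<preceq> \<nu> \<otimes> v" "\<nu> \<preceq> \<mu>" "\<nu> \<in> F" "x \<in> carrier L" for x \<nu>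
      using that dom_mult_right[of \<nu> \<mu> v] vc m by (meson dom_trans F_carrier m_closed)
    show ?thesis
    proof (cases "\<theta> \<preceq> h \<otimes> v \<and> \<theta> \<otimes> y \<preceq> h \<otimes> v")
      case True
      have hv: "h \<otimes> v \<in> carrier L" "\<theta> \<otimes> y \<in> carrier L" using h vc th yc by auto
      have "y \<ominus> g \<preceq> h \<otimes> v" "c \<ominus> u \<preceq> h \<otimes> v"
        using True g u yc c th hv by (meson dom_trans F_carrier minus_closed)+
      then have "(y \<ominus> g) \<oplus> (c \<ominus> u) \<preceq> h \<otimes> v" using g u yc c hv by (simp add: dom_add)
      moreover have "v \<ominus> (g \<oplus> u) = (y \<ominus> g) \<oplus> (c \<ominus> u)"
        unfolding v using yc c F_carrier[OF g(1)] F_carrier[OF u(1)] by algebra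
      ultimately have "v \<ominus> (g \<oplus> u) \<preceq> \<mu> \<otimes> v" using dom_mu[of _ h] m h g u vc yc c by simp
      then show ?thesis using g u by (meson F_add)
    next
      case False
      have small: "v \<preceq> \<omega>"
      proof (cases "h \<otimes> v \<prec> \<theta>")
        case True
        then have "h \<otimes> v \<preceq> \<theta>" using h vc th by (intro sdom_imp_dom) auto
        then show ?thesis using dom_divide_iff[of h \<theta> v] h h0 vc th by (simp add: \<omega>_def m_comm)
      next
        case b: False
        then have lt: "h \<otimes> v \<prec> \<theta> \<otimes> y" using False by simp
        then have "y \<noteq> \<zero>" using th h vc by auto
        \<comment> \<open>Here \<open>y\<close> and \<open>c\<close> cancel: \<open>v\<close> is
          strictly below \<open>y\<close>, so \<open>y\<close> has the size of the constant
          \<open>c\<close> and is at most 1. The bound by \<open>\<theta> \<otimes> y\<close> thus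
          becomes a bound by \<theta>.\<close>
        have "h \<otimes> v \<prec> h \<otimes> y"
          using lt dom_mult_right[of \<theta> h y] h th yc vc by (meson dom_total dom_trans F_carrier m_closed)
        then have "v \<prec> y" using dom_cancel_left[of h y v] h h0 yc vc by simp
        moreover have "v = y \<ominus> (\<ominus> c)" unfolding v using yc c by algebra
        ultimately have "y \<preceq> \<ominus> c" using dom_of_diff_sdom(2)[of y "\<ominus> c"] yc c by simp
        then have "y \<preceq> \<one>" using yc c const_dom_one[of c] by (simp, meson dom_trans one_closed)
        then have "\<theta> \<otimes> y \<preceq> \<theta>" using dom_mult_le[of \<theta> \<theta> y] th yc by simp
        then have "h \<otimes> v \<preceq> \<theta>" using lt h vc th yc by (meson dom_total dom_trans F_carrier m_closed)
        then show ?thesis using dom_divide_iff[of h \<theta> v] h h0 vc th by (simp add: \<omega>_def m_comm)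
      qed
      show ?thesis
      proof (cases "v = \<zero>")
        case True
        then show ?thesis using m by (intro bexI[of _ \<zero>]) (auto simp: minus_eq)
      next
        case v0: False
        \<comment> \<open>Differentiation kills \<open>c\<close>, so \<open>D v\<close> lies in the
          smaller span and has an approximation of precision \<theta>. As \<open>v\<close> is small,
          integrating it yields an approximation of \<open>v\<close>.\<close>
        have "D v = D y" unfolding v using c yc by simp
        then have "D v \<in> const_span cs" using const_span_D cs y by simp
        then obtain d where d: "d \<in> F" "D v \<ominus> d \<preceq> \<theta> \<otimes> D v" using th(4) by (auto simp: approximable_def)
        obtain f where f: "f \<in> F" "v \<ominus> f \<preceq> \<kappa> \<otimes> v" using k(4)[OF vc v0 small d] by auto
        then have "v \<ominus> f \<preceq> \<mu> \<otimes> v" using dom_mu[of _ \<kappa>] m k vc by simp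
        then show ?thesis using f by blast
      qed
    qed
  qed
  have "approximable \<mu> (const_span (c # cs))"
    unfolding approximable_def
  proof
    fix w assume "w \<in> const_span (c # cs)"
    then obtain x f where w: "w = x \<oplus> f \<otimes> c" "x \<in> const_span cs" "f \<in> F" by auto
    have xc: "x \<in> carrier L" using const_span_carrier[OF _ w(2)] cs by simp
    show "\<exists>b\<in>F. w \<ominus> b \<preceq> \<mu> \<otimes> w"
    proof (cases "f = \<zero>")
      case True
      have "approximable \<mu> (const_span cs)"
        using approximable_mono[OF th(4) le_mu th(1) m(1)] const_span_carrier[of cs] cs by auto
      then show ?thesis using w True xc c by (auto simp: approximable_def)
    next
      case False
      define v where "v = inv f \<otimes> x \<oplus> c"
      have if_F: "inv f \<in> F" using w False by simp
      have v: "v \<in> carrier L" using xc c if_F by (simp add: v_def)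
      have "f \<otimes> v = (f \<otimes> inv f) \<otimes> x \<oplus> f \<otimes> c"
        unfolding v_def using F_carrier[OF w(3)] F_carrier[OF if_F] xc c by algebra
      then have fv: "w = f \<otimes> v" using w False xc by simp
      have "inv f \<otimes> x \<in> const_span cs" using const_span_scale cs w if_F by simp
      then obtain b where b: "b \<in> F" "v \<ominus> b \<preceq> \<mu> \<otimes> v" using monic v_def by blast
      have "f \<otimes> (v \<ominus> b) \<preceq> f \<otimes> (\<mu> \<otimes> v)" using b dom_cancel_left[of f] False w v m by simp
      moreover have "f \<otimes> (v \<ominus> b) = w \<ominus> f \<otimes> b" "f \<otimes> (\<mu> \<otimes> v) = \<mu> \<otimes> w"
        unfolding fv using v F_carrier[OF w(3)] F_carrier[OF b(1)] F_carrier[OF m(1)] by algebra+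
      ultimately show ?thesis using w b by (metis F_mult)
    qed
  qed
  then show ?thesis using m m0 by blast
qed

text \<open>Elements of \<open>F\<close> approximate themselves, so any nonzero infinitesimal starts
  the induction. In the step, \<open>c \<ominus> u\<close> may lie outside \<open>F\<close>, but its
  derivative is \<open>\<ominus> D u\<close> and lies in \<open>F\<close>; hence
  \<open>ex_infinitesimal_bound\<close> dominates it by an infinitesimal of \<open>F\<close>.
  Enlarging the precision covers both this error and the span already treated.\<close>

lemma ex_const_span_approximable:
  assumes "set cs \<subseteq> consts_near"
  shows "\<exists>\<kappa>\<in>F. \<kappa> \<noteq> \<zero> \<and> \<kappa> \<prec> \<one> \<and> approximable \<kappa> (const_span cs)"
  using assms
proof (induction cs)
  case Nil
  obtain g where g: "g \<in> F" "\<one> \<prec> g" using lambda[of \<zero>] by auto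
  then have g0: "g \<noteq> \<zero>" by auto
  then have "inv g \<in> F" "inv g \<noteq> \<zero>" "inv g \<prec> \<one>" using g inv_sdom_one_iff by auto
  moreover have "approximable (inv g) (const_span [])"
    unfolding approximable_def
  proof
    fix w assume "w \<in> const_span []"
    then show "\<exists>f\<in>F. w \<ominus> f \<preceq> inv g \<otimes> w" using g g0 by (intro bexI[of _ w]) (auto simp: minus_eq r_neg)
  qed
  ultimately show ?case by blast
next
  case (Cons c cs)
  then obtain \<theta> where th: "\<theta> \<in> F" "\<theta> \<noteq> \<zero>" "\<theta> \<prec> \<one>" "approximable \<theta> (const_span cs)" by auto
  obtain u where u: "u \<in> F" "c \<ominus> u \<prec> \<one>" using Cons.prems ex_near[of c] by auto
  have c: "c \<in> carrier L" "D c = \<zero>" using Cons.prems by auto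
  obtain \<eta> where eta: "\<eta> \<in> F" "\<eta> \<prec> \<one>" "c \<ominus> u \<preceq> \<eta>"
  proof (cases "c \<ominus> u = \<zero>")
    case True then show ?thesis using that[of \<theta>] th by simp
  next
    case False
    have "D (c \<ominus> u) \<in> F" using c u D_in by (simp add: minus_eq)
    then show ?thesis using that ex_infinitesimal_bound[of "c \<ominus> u"] u c False by auto
  qed
  obtain \<nu> where nu: "\<nu> \<in> F" "\<nu> \<prec> \<one>" "\<theta> \<preceq> \<nu>" "\<eta> \<preceq> \<nu>"
    using ex_common_bound[OF th(1) eta(1) th(3) eta(2)] by auto
  have "\<nu> \<noteq> \<zero>" using nu th dom_zero by auto
  moreover have "approximable \<nu> (const_span cs)"
    using approximable_mono[OF th(4) nu(3) th(1) nu(1)] const_span_carrier[of cs] Cons.prems by auto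
  moreover have "c \<ominus> u \<preceq> \<nu>" using eta nu u c by (meson dom_trans F_carrier minus_closed)
  ultimately show ?case using const_span_approximable_step[OF Cons.prems nu(1) _ nu(2) _ u(1)] by blast
qed

end


section \<open>The differential field generated over \<open>F\<close> by the nearby
  constants\<close>

context lambda_free_subfield begin

text \<open>This is the ring generated by \<open>F\<close> and \<open>consts_near\<close>: linear
  combinations suffice because \<open>consts_near\<close> is closed under products.\<close>

definition const_alg :: "'a set" where
  "const_alg = (\<Union>cs\<in>{cs. set cs \<subseteq> consts_near}. const_span cs)"

lemma const_alg_common:
  assumes "x \<in> const_alg" "y \<in> const_alg"
  obtains cs where "set cs \<subseteq> consts_near" "x \<in> const_span cs" "y \<in> const_span cs"
proof -
  obtain cs ds where "set cs \<subseteq> consts_near" "x \<in> const_span cs" "set ds \<subseteq> consts_near" "y \<in> const_span ds"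
    using assms by (auto simp: const_alg_def)
  then show thesis
    using that[of "cs @ ds"] const_span_append_left const_span_append_right by simp
qed

lemma const_alg_I: "set cs \<subseteq> consts_near \<Longrightarrow> x \<in> const_span cs \<Longrightarrow> x \<in> const_alg"
  by (auto simp: const_alg_def)

lemma const_alg_carrier [simp]: "x \<in> const_alg \<Longrightarrow> x \<in> carrier L"
  using const_span_carrier by (auto simp: const_alg_def)

lemma F_subset_const_alg [simp]: "x \<in> F \<Longrightarrow> x \<in> const_alg"
  by (rule const_alg_I[of "[]"]) auto

lemma const_alg_add [simp]: "x \<in> const_alg \<Longrightarrow> y \<in> const_alg \<Longrightarrow> x \<oplus> y \<in> const_alg"
  by (meson const_alg_common const_alg_I const_span_add)

lemma const_alg_diff [simp]: "x \<in> const_alg \<Longrightarrow> y \<in> const_alg \<Longrightarrow> x \<ominus> y \<in> const_alg"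
  by (meson const_alg_common const_alg_I const_span_diff)

lemma const_alg_D: "x \<in> const_alg \<Longrightarrow> D x \<in> const_alg"
  by (meson const_alg_common const_alg_I const_span_D)

lemma const_alg_scale: "x \<in> const_alg \<Longrightarrow> f \<in> F \<Longrightarrow> f \<otimes> x \<in> const_alg"
  by (meson const_alg_common const_alg_I const_span_scale)

lemma consts_near_subset_alg [simp]: assumes "c \<in> consts_near" shows "c \<in> const_alg"
proof (rule const_alg_I[of "[c]"])
  have "c = \<zero> \<oplus> \<one> \<otimes> c" using assms by simp
  then show "c \<in> const_span [c]" using F_zero F_one by (auto simp del: F_zero F_one)
qed (use assms in simp)

text \<open>Constants are dominated by 1, hence so are elements of \<open>F\<close> congruent to
  them. The error of \<open>u \<otimes> v\<close> is \<open>d \<otimes> (c \<ominus> u) \<oplus> u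
  \<otimes> (d \<ominus> v)\<close>, therefore infinitesimal.\<close>

lemma consts_near_mult:
  assumes "c \<in> consts_near" "d \<in> consts_near" shows "c \<otimes> d \<in> consts_near"
proof -
  obtain u v where u: "u \<in> F" "c \<ominus> u \<prec> \<one>" and v: "v \<in> F" "d \<ominus> v \<prec> \<one>"
    using ex_near[OF assms(1)] ex_near[OF assms(2)] by blast
  have cd: "c \<in> carrier L" "d \<in> carrier L" "D c = \<zero>" "D d = \<zero>" using assms by auto
  have prod: "x \<otimes> y \<prec> \<one>" if "x \<preceq> \<one>" "y \<prec> \<one>" "x \<in> carrier L" "y \<in> carrier L" for x y
    using dom_mult_right[of x \<one> y] that by (simp, meson dom_trans one_closed m_closed)
  have c1: "c \<preceq> \<one>" "d \<preceq> \<one>" using cd const_dom_one by auto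
  have "u = c \<ominus> (c \<ominus> u)" using cd F_carrier[OF u(1)] by algebra
  then have "u \<preceq> \<one>" using dom_diff[of c \<one> "c \<ominus> u"] c1 cd u sdom_imp_dom[of \<one> "c \<ominus> u"] by simp
  then have "d \<otimes> (c \<ominus> u) \<oplus> u \<otimes> (d \<ominus> v) \<prec> \<one>"
    using prod c1 cd u v by (intro sdom_add) auto
  moreover have "d \<otimes> (c \<ominus> u) \<oplus> u \<otimes> (d \<ominus> v) = c \<otimes> d \<ominus> u \<otimes> v"
    using cd F_carrier[OF u(1)] F_carrier[OF v(1)] by algebra
  ultimately have "c \<otimes> d \<ominus> u \<otimes> v \<prec> \<one>" by simp
  moreover have "D (c \<otimes> d) = \<zero>" using cd by (simp add: D_mult)
  ultimately show ?thesis using cd u v F_mult unfolding consts_near_def by blast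
qed

lemma const_alg_mult_const:
  assumes "d \<in> consts_near" "set cs \<subseteq> consts_near" "x \<in> const_span cs" shows "x \<otimes> d \<in> const_alg"
  using assms(2,3)
proof (induction cs arbitrary: x)
  case Nil
  then show ?case using const_alg_scale assms(1) by simp
next
  case (Cons c cs)
  obtain y f where e: "x = y \<oplus> f \<otimes> c" "y \<in> const_span cs" "f \<in> F" using Cons.prems by auto
  have "c \<in> consts_near" using Cons.prems by simp
  have yc: "y \<in> carrier L" using const_span_carrier[OF _ e(2)] Cons.prems by simp
  have "x \<otimes> d = y \<otimes> d \<oplus> f \<otimes> (c \<otimes> d)"
    unfolding e(1) using yc F_carrier[OF e(3)] consts_nearD(1)[OF assms(1)]
      consts_nearD(1)[OF \<open>c \<in> consts_near\<close>] by algebra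
  moreover have "y \<otimes> d \<in> const_alg" using Cons e by simp
  moreover have "f \<otimes> (c \<otimes> d) \<in> const_alg"
    using const_alg_scale consts_near_mult \<open>c \<in> consts_near\<close> assms(1) e by simp
  ultimately show ?case by simp
qed

lemma const_alg_mult [simp]:
  assumes "x \<in> const_alg" "y \<in> const_alg" shows "x \<otimes> y \<in> const_alg"
proof -
  obtain cs where cs: "set cs \<subseteq> consts_near" "y \<in> const_span cs" using assms const_alg_common by blast
  then show ?thesis
  proof (induction cs arbitrary: y)
    case Nil
    then show ?case using const_alg_scale[OF assms(1)] assms m_comm[of x y] by simp
  next
    case (Cons c cs)
    obtain z f where e: "y = z \<oplus> f \<otimes> c" "z \<in> const_span cs" "f \<in> F" using Cons.prems by auto
    have c: "c \<in> consts_near" using Cons.prems by simp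
    have zc: "z \<in> carrier L" using const_span_carrier[OF _ e(2)] Cons.prems by simp
    have "x \<otimes> y = x \<otimes> z \<oplus> f \<otimes> (x \<otimes> c)"
      unfolding e(1) using zc F_carrier[OF e(3)] consts_nearD(1)[OF c] const_alg_carrier[OF assms(1)] by algebra
    moreover have "x \<otimes> z \<in> const_alg" using Cons e by simp
    moreover have "f \<otimes> (x \<otimes> c) \<in> const_alg"
      using const_alg_scale[OF _ e(3)] const_alg_mult_const c assms(1) const_alg_common by metis
    ultimately show ?case by simp
  qed
qed

definition const_ext :: "'a set" where
  "const_ext = {w \<otimes> inv v | w v. w \<in> const_alg \<and> v \<in> const_alg \<and> v \<noteq> \<zero>}"

lemma const_alg_subset_ext [simp]:
  assumes "x \<in> const_alg" shows "x \<in> const_ext"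
proof -
  have "x = x \<otimes> inv \<one>" using assms by simp
  then show ?thesis unfolding const_ext_def using assms F_subset_const_alg[OF F_one] one_not_zero by blast
qed

lemma const_ext_I: "w \<in> const_alg \<Longrightarrow> v \<in> const_alg \<Longrightarrow> v \<noteq> \<zero> \<Longrightarrow> w \<otimes> inv v \<in> const_ext"
  unfolding const_ext_def by blast

lemma const_ext_carrier [simp]: "x \<in> const_ext \<Longrightarrow> x \<in> carrier L"
  unfolding const_ext_def by auto

lemma const_ext_subfield: "subfield const_ext L"
proof (rule subfieldI')
  show "subring const_ext L"
  proof (rule subringI)
    show "const_ext \<subseteq> carrier L" by auto
    show "\<one> \<in> const_ext" by simp
  next
    fix x assume "x \<in> const_ext"
    then obtain w v where e: "x = w \<otimes> inv v" "w \<in> const_alg" "v \<in> const_alg" "v \<noteq> \<zero>" by (auto simp: const_ext_def)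
    have "\<ominus> x = (\<zero> \<ominus> w) \<otimes> inv v" using e by (simp add: l_minus minus_eq)
    then show "\<ominus> x \<in> const_ext" using e const_ext_I[of "\<zero> \<ominus> w" v] by simp
  next
    fix x y assume "x \<in> const_ext" "y \<in> const_ext"
    then obtain w v w' v' where e: "x = w \<otimes> inv v" "w \<in> const_alg" "v \<in> const_alg" "v \<noteq> \<zero>"
      "y = w' \<otimes> inv v'" "w' \<in> const_alg" "v' \<in> const_alg" "v' \<noteq> \<zero>" by (auto simp: const_ext_def)
    have c: "w \<in> carrier L" "v \<in> carrier L" "w' \<in> carrier L" "v' \<in> carrier L"
      "inv v \<in> carrier L" "inv v' \<in> carrier L" using e by auto
    have u: "v \<otimes> inv v = \<one>" "v' \<otimes> inv v' = \<one>" using e by auto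
    have vv: "v \<otimes> v' \<noteq> \<zero>" using e by (simp add: integral_iff)
    have "x \<otimes> y = (w \<otimes> w') \<otimes> inv (v \<otimes> v')"
      unfolding e(1,5) using inv_mult[OF c(2,4) e(4,8)] c by (simp add: m_ac)
    then show "x \<otimes> y \<in> const_ext" using e vv const_ext_I[of "w \<otimes> w'" "v \<otimes> v'"] by simp
    have "x \<oplus> y = w \<otimes> inv v \<otimes> (v' \<otimes> inv v') \<oplus> w' \<otimes> inv v' \<otimes> (v \<otimes> inv v)"
      unfolding e(1,5) u using c by simp
    also have "\<dots> = (w \<otimes> v' \<oplus> w' \<otimes> v) \<otimes> (inv v \<otimes> inv v')" using c by algebra
    also have "\<dots> = (w \<otimes> v' \<oplus> w' \<otimes> v) \<otimes> inv (v \<otimes> v')" using inv_mult[OF c(2,4) e(4,8)] by simp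
    finally show "x \<oplus> y \<in> const_ext" using e vv const_ext_I[of "w \<otimes> v' \<oplus> w' \<otimes> v" "v \<otimes> v'"] by simp
  qed
next
  fix x assume x: "x \<in> const_ext - {\<zero>}"
  then obtain w v where e: "x = w \<otimes> inv v" "w \<in> const_alg" "v \<in> const_alg" "v \<noteq> \<zero>" by (auto simp: const_ext_def)
  have w: "w \<noteq> \<zero>" using x e by auto
  have i: "v \<otimes> inv v = \<one>" "w \<otimes> inv w = \<one>" "inv v \<in> carrier L" "inv w \<in> carrier L" using e w by auto
  have "x \<otimes> (v \<otimes> inv w) = (v \<otimes> inv v) \<otimes> (w \<otimes> inv w)"
    unfolding e(1) using const_alg_carrier[OF e(2)] const_alg_carrier[OF e(3)] i(3,4) by algebra
  then have "x \<otimes> (v \<otimes> inv w) = \<one>" unfolding i by simp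
  then have "inv x = v \<otimes> inv w" using x e w by (intro comm_inv_char) auto
  then show "inv x \<in> const_ext" using e w const_ext_I by simp
qed

lemma const_ext_D: assumes "x \<in> const_ext" shows "D x \<in> const_ext"
proof -
  obtain w v where e: "x = w \<otimes> inv v" "w \<in> const_alg" "v \<in> const_alg" "v \<noteq> \<zero>" using assms by (auto simp: const_ext_def)
  have vE: "inv v \<in> const_ext" using const_ext_I[of \<one> v] e by simp
  have "D (inv v) = \<ominus> (D v \<otimes> inv v \<otimes> inv v)" using D_inv e by simp
  then have "D x = D w \<otimes> inv v \<oplus> w \<otimes> (\<ominus> (D v \<otimes> inv v \<otimes> inv v))" using e by (simp add: D_mult)
  then show ?thesis using e vE const_alg_D subringE(5-7)[OF subfieldE(1)[OF const_ext_subfield]] by simp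
qed

text \<open>Numerator \<open>w\<close> and denominator \<open>v\<close> of \<open>z\<close> share
  one span, which also contains \<open>w \<ominus> a \<otimes> v\<close> for every \<open>a\<close>
  in \<open>F\<close>. The precision of that span therefore works for all \<open>a\<close>, and
  \<open>b\<close> adds to \<open>a\<close> a quotient of approximations in \<open>F\<close> of the
  numerator and denominator of \<open>z \<ominus> a\<close>.\<close>

lemma ex_uniform_approx:
  assumes "z \<in> const_ext"
  obtains \<kappa> where "\<kappa> \<in> F" "\<kappa> \<noteq> \<zero>" "\<kappa> \<prec> \<one>"
    "\<And>a. a \<in> F \<Longrightarrow> \<exists>b\<in>F. z \<ominus> b \<preceq> \<kappa> \<otimes> (z \<ominus> a)"
proof -
  obtain w v where z: "z = w \<otimes> inv v" "w \<in> const_alg" "v \<in> const_alg" "v \<noteq> \<zero>" using assms by (auto simp: const_ext_def)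
  obtain cs where cs: "set cs \<subseteq> consts_near" "w \<in> const_span cs" "v \<in> const_span cs"
    using const_alg_common z by blast
  obtain \<kappa> where k: "\<kappa> \<in> F" "\<kappa> \<noteq> \<zero>" "\<kappa> \<prec> \<one>" "approximable \<kappa> (const_span cs)"
    using ex_const_span_approximable[OF cs(1)] by blast
  have c: "w \<in> carrier L" "v \<in> carrier L" "inv v \<in> carrier L" "\<kappa> \<in> carrier L" using z k by auto
  have zv: "z \<otimes> v = w" using z c by (simp add: m_assoc)
  have zc: "z \<in> carrier L" using z c by simp
  obtain g where g: "g \<in> F" "v \<ominus> g \<preceq> \<kappa> \<otimes> v" using k cs by (auto simp: approximable_def)
  have gc: "g \<in> carrier L" using g by simp
  have "\<kappa> \<otimes> v \<prec> v" using dom_cancel_right[of v \<one> \<kappa>] k c z by simp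
  then have "v \<ominus> g \<prec> v" using g c gc by (meson dom_trans minus_closed m_closed)
  then have vg: "v \<preceq> g" using dom_of_diff_sdom c gc by blast
  then have g0: "g \<noteq> \<zero>" using z c dom_zero by blast
  show thesis
  proof (rule that[OF k(1-3)])
    fix a assume a: "a \<in> F"
    have ac: "a \<in> carrier L" using a by simp
    define n where "n = w \<ominus> a \<otimes> v"
    have nc: "n \<in> carrier L" using c ac by (simp add: n_def)
    have "n \<in> const_span cs" using cs a by (simp add: n_def const_span_diff const_span_scale)
    then obtain f where f: "f \<in> F" "n \<ominus> f \<preceq> \<kappa> \<otimes> n" using k by (auto simp: approximable_def)
    have fc: "f \<in> carrier L" using f by simp
    define b where "b = a \<oplus> f \<otimes> inv g"
    have b: "b \<in> F" using a f g g0 by (simp add: b_def)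
    have bc: "b \<in> carrier L" using b by simp
    have bg: "b \<otimes> g = a \<otimes> g \<oplus> f"
      using ac fc gc g0 by (simp add: b_def l_distr m_assoc)
    have za: "(z \<ominus> a) \<otimes> v = n" unfolding n_def zv[symmetric] using zc ac c by algebra
    \<comment> \<open>Clearing denominators expresses the new error through the errors
      \<open>n \<ominus> f\<close> and \<open>v \<ominus> g\<close>, both of relative size at most
      \<kappa>.\<close>
    have "(z \<ominus> b) \<otimes> (v \<otimes> g) = (z \<otimes> v) \<otimes> g \<ominus> (b \<otimes> g) \<otimes> v" using zc bc c gc by algebra
    also have "\<dots> = (w \<ominus> a \<otimes> v) \<otimes> g \<ominus> f \<otimes> v" unfolding bg zv using ac c gc fc by algebra
    also have "\<dots> = v \<otimes> (n \<ominus> f) \<ominus> n \<otimes> (v \<ominus> g)" unfolding n_def[symmetric] using nc c gc fc by algebra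
    finally have eq: "(z \<ominus> b) \<otimes> (v \<otimes> g) = v \<otimes> (n \<ominus> f) \<ominus> n \<otimes> (v \<ominus> g)" .
    have "v \<otimes> (n \<ominus> f) \<preceq> g \<otimes> (\<kappa> \<otimes> n)" using vg f c gc nc fc by (intro dom_mult) auto
    moreover have "n \<otimes> (v \<ominus> g) \<preceq> g \<otimes> (\<kappa> \<otimes> n)"
    proof -
      have "\<kappa> \<otimes> v \<preceq> \<kappa> \<otimes> g" using vg k c gc by (simp add: dom_cancel_left)
      then have "v \<ominus> g \<preceq> \<kappa> \<otimes> g" using g c gc by (meson dom_trans minus_closed m_closed)
      then have "n \<otimes> (v \<ominus> g) \<preceq> n \<otimes> (\<kappa> \<otimes> g)" using nc c gc by (intro dom_mult) auto
      moreover have "n \<otimes> (\<kappa> \<otimes> g) = g \<otimes> (\<kappa> \<otimes> n)" using nc c gc by algebra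
      ultimately show ?thesis by simp
    qed
    ultimately have "(z \<ominus> b) \<otimes> (v \<otimes> g) \<preceq> g \<otimes> (\<kappa> \<otimes> n)"
      unfolding eq using c gc nc fc by (intro dom_diff) auto
    also have "g \<otimes> (\<kappa> \<otimes> n) = (\<kappa> \<otimes> (z \<ominus> a)) \<otimes> (v \<otimes> g)"
      unfolding za[symmetric] using zc ac c gc by algebra
    finally have "z \<ominus> b \<preceq> \<kappa> \<otimes> (z \<ominus> a)"
      using dom_cancel_right[of "v \<otimes> g"] c gc zc bc ac z g0 nc by (simp add: integral_iff)
    then show "\<exists>b\<in>F. z \<ominus> b \<preceq> \<kappa> \<otimes> (z \<ominus> a)" using b by blast
  qed
qed

text \<open>The case \<open>a = \<zero>\<close> of the uniform approximation. It says that the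
  extension of \<open>F\<close> is immediate: neither new values nor new residues appear.\<close>

lemma const_ext_immediate:
  assumes "z \<in> const_ext" "z \<noteq> \<zero>"
  obtains b where "b \<in> F" "z \<ominus> b \<prec> z"
proof -
  obtain \<kappa> where k: "\<kappa> \<in> F" "\<kappa> \<prec> \<one>" "\<And>a. a \<in> F \<Longrightarrow> \<exists>b\<in>F. z \<ominus> b \<preceq> \<kappa> \<otimes> (z \<ominus> a)"
    using ex_uniform_approx[OF assms(1)] by metis
  obtain b where b: "b \<in> F" "z \<ominus> b \<preceq> \<kappa> \<otimes> z" using k(3)[of \<zero>] assms by (auto simp: minus_eq)
  have "\<kappa> \<otimes> z \<prec> z" using dom_cancel_right[of z \<one> \<kappa>] k assms by simp
  then have "z \<ominus> b \<prec> z" using b k assms by (meson dom_trans minus_closed m_closed F_carrier const_ext_carrier)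
  then show thesis using that b by blast
qed

text \<open>An infinitesimal \<open>x\<close> has the valuation of some \<open>b\<close> in
  \<open>F\<close>, and \<open>ld b \<preceq> ld x\<close> by antitonicity, so the witness for
  \<open>b\<close> also serves \<open>x\<close>. Large elements are inverted first.\<close>

lemma const_ext_not_grounded:
  assumes "g \<in> const_ext" "g \<noteq> \<zero>" "g \<prec> \<one> \<or> \<one> \<prec> g"
  shows "\<exists>h\<in>F. h \<noteq> \<zero> \<and> h \<prec> \<one> \<and> ld h \<prec> ld g"
proof -
  have small: "\<exists>h\<in>F. h \<noteq> \<zero> \<and> h \<prec> \<one> \<and> ld h \<prec> ld x" if "x \<in> const_ext" "x \<noteq> \<zero>" "x \<prec> \<one>" for x
  proof -
    obtain b where b: "b \<in> F" "x \<ominus> b \<prec> x" by (rule const_ext_immediate[OF \<open>x \<in> const_ext\<close> \<open>x \<noteq> \<zero>\<close>])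
    then have bx: "b \<preceq> x" "x \<preceq> b" using dom_of_diff_sdom[OF b(2)] that b(1) by simp_all
    then have b0: "b \<noteq> \<zero>" using dom_zero[of x] that by auto
    have b1: "b \<prec> \<one>" using bx that b by (meson dom_trans const_ext_carrier F_carrier one_closed)
    then obtain h where h: "h \<in> F" "h \<noteq> \<zero>" "h \<prec> \<one>" "ld h \<prec> ld b" using ungrounded[OF b(1) b0 b1] by blast
    moreover have "ld b \<preceq> ld x" using ldv_antimono[of x b] bx b b0 b1 that by simp
    ultimately have "ld h \<prec> ld x" using that b b0 by (meson dom_trans ldv_closed const_ext_carrier F_carrier)
    then show ?thesis using h by blast
  qed
  show ?thesis
  proof (cases "g \<prec> \<one>")
    case True then show ?thesis using small assms by blast
  next
    case False
    then have "\<one> \<prec> g" using assms by blast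
    then have "inv g \<prec> \<one>" using inv_sdom_one_iff assms by simp
    moreover have "inv g \<in> const_ext" using subfield_m_inv(1)[OF const_ext_subfield, of g] assms by blast
    ultimately obtain h where h: "h \<in> F" "h \<noteq> \<zero>" "h \<prec> \<one>" "ld h \<prec> ld (inv g)"
      using small[of "inv g"] assms by auto
    then have "ld h \<prec> ld g" using assms by (simp add: ldv_inv)
    then show ?thesis using h by blast
  qed
qed

lemma const_ext_lambda:
  assumes s: "s \<in> const_ext"
  shows "\<exists>g\<in>F. \<one> \<prec> g \<and> ld g \<preceq> s \<ominus> ld (ld g)"
proof (rule ccontr)
  assume "\<not> ?thesis"
  then have neg: "s \<ominus> ld (ld g) \<prec> ld g" if "g \<in> F" "\<one> \<prec> g" for g using that by blast
  have sc: "s \<in> carrier L" using s by simp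
  obtain \<kappa> where k: "\<kappa> \<in> F" "\<kappa> \<noteq> \<zero>" "\<kappa> \<prec> \<one>"
    "\<And>a. a \<in> F \<Longrightarrow> \<exists>b\<in>F. s \<ominus> b \<preceq> \<kappa> \<otimes> (s \<ominus> a)"
    using ex_uniform_approx[OF s] by metis
  define g where "g = inv \<kappa>"
  have g: "g \<in> F" "g \<noteq> \<zero>" "\<one> \<prec> g" using k one_sdom_inv_iff[of \<kappa>] by (auto simp: g_def)
  have lg: "ld g \<in> F" "ld g \<noteq> \<zero>" using g ldv_nonzero[of g] by auto
  obtain b where b: "b \<in> F" "s \<ominus> b \<preceq> \<kappa> \<otimes> (s \<ominus> ld (ld g))" using k(4)[of "ld (ld g)"] lg by auto
  have "\<kappa> \<otimes> (s \<ominus> ld (ld g)) \<preceq> \<kappa> \<otimes> ld g"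
    using neg[OF g(1,3)] sdom_imp_dom[of "ld g" "s \<ominus> ld (ld g)"] k lg s by (simp add: dom_cancel_left)
  moreover have "\<kappa> \<otimes> ld g = \<ominus> D \<kappa>"
    using k D_eq_ldv[of \<kappa>] by (simp add: g_def ldv_inv r_minus)
  ultimately have sb: "s \<ominus> b \<preceq> D \<kappa>"
    using b k lg s by (simp, meson dom_trans minus_closed m_closed F_carrier const_ext_carrier D_closed ldv_closed)
  obtain h where h: "h \<in> F" "\<one> \<prec> h" "ld h \<preceq> b \<ominus> ld (ld h)" using lambda[OF b(1)] by blast
  have h0: "h \<noteq> \<zero>" using h(2) by auto
  have lh: "ld h \<in> F" "ld h \<noteq> \<zero>" using h h0 ldv_nonzero[of h] by auto
  then have llh: "ld (ld h) \<in> carrier L" by simp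
  \<comment> \<open>Hence \<open>s\<close> and \<open>b\<close> differ by less than
    \<open>ld h\<close>, and the failure at \<open>s\<close> for this \<open>h\<close> carries over
    to \<open>b\<close>, against the choice of \<open>h\<close>.\<close>
  have "D \<kappa> \<prec> ld h" using D_sdom_ldv_large[where f=\<kappa> and g=h] h k by simp
  then have "s \<ominus> b \<prec> ld h" using sb k b s lh by (meson dom_trans minus_closed F_carrier const_ext_carrier D_closed)
  then have "(s \<ominus> ld (ld h)) \<ominus> (s \<ominus> b) \<prec> ld h"
    using neg[OF h(1,2)] \<open>s \<ominus> b \<prec> ld h\<close> sc b lh llh by (intro sdom_diff[OF neg[OF h(1,2)]]) auto
  moreover have "(s \<ominus> ld (ld h)) \<ominus> (s \<ominus> b) = b \<ominus> ld (ld h)"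
    using sc F_carrier[OF b(1)] llh by algebra
  ultimately show False using h by simp
qed

end


section \<open>The universal property\<close>

context field begin

text \<open>The operator \<open>inv\<close> refers to the carrier, so inverses in the substructure
  must be identified with those of the field; uniqueness of inverses does it.\<close>

lemma subfield_restrict_inv:
  assumes "subfield E R" "x \<in> E" "x \<noteq> \<zero>" shows "inv\<^bsub>R\<lparr>carrier := E\<rparr>\<^esub> x = inv x"
proof -
  interpret M: field "R\<lparr>carrier := E\<rparr>" using subfield_iff(2)[OF assms(1)] .
  have "x \<otimes> inv\<^bsub>R\<lparr>carrier := E\<rparr>\<^esub> x = \<one>" "inv\<^bsub>R\<lparr>carrier := E\<rparr>\<^esub> x \<in> E"
    using M.inv_nonzero[of x] assms by auto
  then show ?thesis using assms(2) subfieldE(3)[OF assms(1)] by (metis comm_inv_char subsetD)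
qed

lemma subfield_restrict_minus:
  assumes "subfield E R" "x \<in> E" "y \<in> E" shows "x \<ominus>\<^bsub>R\<lparr>carrier := E\<rparr>\<^esub> y = x \<ominus> y"
proof -
  interpret M: field "R\<lparr>carrier := E\<rparr>" using subfield_iff(2)[OF assms(1)] .
  have "\<ominus>\<^bsub>R\<lparr>carrier := E\<rparr>\<^esub> y \<oplus> y = \<zero>" "\<ominus>\<^bsub>R\<lparr>carrier := E\<rparr>\<^esub> y \<in> E"
    using M.l_neg[of y] M.a_inv_closed[of y] assms by auto
  then have "\<ominus>\<^bsub>R\<lparr>carrier := E\<rparr>\<^esub> y = \<ominus> y"
    using assms(3) subfieldE(3)[OF assms(1)] by (metis minus_equality subsetD)
  then show ?thesis by (simp add: a_minus_def)
qed

end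

context H_asymptotic_field begin

context
  fixes E
  assumes E: "subfield E L" and D_E: "\<And>x. x \<in> E \<Longrightarrow> D x \<in> E"
begin

lemma subfield_mem_carrier: "x \<in> E \<Longrightarrow> x \<in> carrier L"
  using subfieldE(3)[OF E] by blast

lemma restrict_ldv: "x \<in> E \<Longrightarrow> x \<noteq> \<zero> \<Longrightarrow> ldv (L\<lparr>carrier := E\<rparr>) x = ld x"
  by (simp add: ldv_def subfield_restrict_inv[OF E])

lemma restrict_prec: "prec (L\<lparr>carrier := E\<rparr>) f g \<longleftrightarrow> prec L f g"
  by (simp add: prec_def)

lemma restrict_valued_diff_field: "valued_diff_field (L\<lparr>carrier := E\<rparr>)"
  unfolding valued_diff_field_def
proof (intro conjI)
  show "field (L\<lparr>carrier := E\<rparr>)" using subfield_iff(2)[OF E] .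
  show "derivation (L\<lparr>carrier := E\<rparr>)"
    unfolding derivation_def using D_E by (auto simp: D_mult subfield_mem_carrier)
  have "valued_diff_field L" using asymptotic by (simp add: asymptotic_def)
  then have "\<forall>n::nat. n > 0 \<longrightarrow> add_pow L n \<one> \<noteq> \<zero>" by (simp add: valued_diff_field_def)
  then show "\<forall>n::nat. n > 0 \<longrightarrow> add_pow (L\<lparr>carrier := E\<rparr>) n \<one>\<^bsub>L\<lparr>carrier := E\<rparr>\<^esub> \<noteq> \<zero>\<^bsub>L\<lparr>carrier := E\<rparr>\<^esub>"
    by (simp add: add_pow_def nat_pow_def)
  show "dominance (L\<lparr>carrier := E\<rparr>)"
    unfolding dominance_def
  proof (intro conjI ballI impI, goal_cases)
    case (3 f g h)
    then show ?case using dom_trans[of f g h] by (simp add: subfield_mem_carrier)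
  next
    case (4 f g)
    then show ?case using dom_total[of f g] by (simp add: subfield_mem_carrier)
  next
    case (5 f g h)
    then show ?case using dom_mult_right[of f g h] by (simp add: subfield_mem_carrier)
  next
    case (6 f g h)
    then show ?case using dom_diff[of f h g] by (simp add: subfield_restrict_minus[OF E] subfield_mem_carrier)
  qed (simp_all add: subfield_mem_carrier)
qed

lemma restrict_asymptotic: "asymptotic (L\<lparr>carrier := E\<rparr>)"
  unfolding asymptotic_def
proof (intro conjI restrict_valued_diff_field ballI impI)
  fix f g
  assume f: "f \<in> nonzero (L\<lparr>carrier := E\<rparr>)" and g: "g \<in> nonzero (L\<lparr>carrier := E\<rparr>)"
    and "prec (L\<lparr>carrier := E\<rparr>) f \<one>\<^bsub>L\<lparr>carrier := E\<rparr>\<^esub> \<and> prec (L\<lparr>carrier := E\<rparr>) g \<one>\<^bsub>L\<lparr>carrier := E\<rparr>\<^esub>"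
  then have "D f \<prec> D g \<longleftrightarrow> f \<prec> g" by (intro D_sdom_iff) (auto simp: restrict_prec prec_iff subfield_mem_carrier)
  then show "prec (L\<lparr>carrier := E\<rparr>) f g \<longleftrightarrow>
      prec (L\<lparr>carrier := E\<rparr>) (vder (L\<lparr>carrier := E\<rparr>) f) (vder (L\<lparr>carrier := E\<rparr>) g)"
    using f g by (simp add: restrict_prec prec_iff D_E subfield_mem_carrier)
qed

lemma restrict_H_type: "H_type (L\<lparr>carrier := E\<rparr>)"
  unfolding H_type_def
proof (intro conjI restrict_valued_diff_field ballI impI)
  fix f g
  assume f: "f \<in> nonzero (L\<lparr>carrier := E\<rparr>)" and g: "g \<in> nonzero (L\<lparr>carrier := E\<rparr>)"
    and "prec (L\<lparr>carrier := E\<rparr>) f g \<and> prec (L\<lparr>carrier := E\<rparr>) g \<one>\<^bsub>L\<lparr>carrier := E\<rparr>\<^esub>"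
  then have "ld g \<preceq> ld f" by (intro ldv_antimono) (auto simp: restrict_prec prec_def subfield_mem_carrier)
  then show "preceq (L\<lparr>carrier := E\<rparr>) (ldv (L\<lparr>carrier := E\<rparr>) g) (ldv (L\<lparr>carrier := E\<rparr>) f)"
    using f g by (simp add: preceq_def restrict_ldv)
qed

lemma restrict_d_valued:
  assumes "\<And>f. f \<in> E \<Longrightarrow> asymp L f \<one> \<Longrightarrow> \<exists>c\<in>E. D c = \<zero> \<and> sim L f c"
  shows "d_valued (L\<lparr>carrier := E\<rparr>)"
  unfolding d_valued_def
proof (intro conjI restrict_asymptotic ballI impI)
  fix f assume f: "f \<in> carrier (L\<lparr>carrier := E\<rparr>)"
    and "asymp (L\<lparr>carrier := E\<rparr>) f \<one>\<^bsub>L\<lparr>carrier := E\<rparr>\<^esub>"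
  then have "asymp L f \<one>" by (simp add: asymp_def)
  then obtain c where "c \<in> E" "D c = \<zero>" "sim L f c" using assms f by auto
  then show "\<exists>c\<in>carrier (L\<lparr>carrier := E\<rparr>). vder (L\<lparr>carrier := E\<rparr>) c = \<zero>\<^bsub>L\<lparr>carrier := E\<rparr>\<^esub>
    \<and> sim (L\<lparr>carrier := E\<rparr>) f c"
    using f by (auto simp: sim_def restrict_prec subfield_restrict_minus[OF E])
qed

end
end

text \<open>The constant \<open>c\<close> with \<open>f\<close> equivalent to \<open>c\<close>
  exists in \<open>L\<close>. Since \<open>f\<close> is also approximated by some \<open>b\<close>
  in \<open>F\<close>, the difference \<open>c \<ominus> b\<close> is infinitesimal, which puts
  \<open>c\<close> among the adjoined constants.\<close>

lemma (in lambda_free_subfield) const_ext_d_valued: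
  assumes "d_valued L"
  shows "d_valued (L\<lparr>carrier := const_ext\<rparr>)"
proof (rule restrict_d_valued[OF const_ext_subfield const_ext_D])
  fix f assume f: "f \<in> const_ext" "asymp L f \<one>"
  then have f1: "f \<preceq> \<one>" "\<one> \<preceq> f" by (auto simp: asymp_def)
  then have "f \<noteq> \<zero>" by auto
  obtain c where c: "c \<in> carrier L" "D c = \<zero>" "f \<ominus> c \<prec> c"
    using assms f unfolding d_valued_def by (auto simp: sim_def prec_iff)
  have c1: "c \<preceq> \<one>" using c const_dom_one by blast
  have fc: "f \<ominus> c \<prec> \<one>" using c c1 f by (meson dom_trans const_ext_carrier minus_closed one_closed)
  obtain b where b: "b \<in> F" "f \<ominus> b \<prec> f" using const_ext_immediate[OF f(1) \<open>f \<noteq> \<zero>\<close>] by blast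
  have fb: "f \<ominus> b \<prec> \<one>" using b f f1 by (meson dom_trans const_ext_carrier F_carrier minus_closed one_closed)
  have "(f \<ominus> b) \<ominus> (f \<ominus> c) \<prec> \<one>" using fc f b c by (intro sdom_diff[OF fb]) auto
  moreover have "(f \<ominus> b) \<ominus> (f \<ominus> c) = c \<ominus> b"
    using const_ext_carrier[OF f(1)] F_carrier[OF b(1)] c(1) by algebra
  ultimately have "c \<ominus> b \<prec> \<one>" by simp
  then have "c \<in> consts_near" using b c unfolding consts_near_def by blast
  then show "\<exists>c\<in>const_ext. D c = \<zero> \<and> sim L f c"
    using c f by (intro bexI[of _ c]) (auto simp: sim_def prec_iff)
qed auto

lemma (in H_asymptotic_field) embedding_lambda_free_subfield:
  assumes e: "vdf_emb i K L" and lf: "lambda_free K"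
  shows "lambda_free_subfield L (i ` carrier K)"
proof -
  have K_asym: "asymptotic K" "H_type K" using lf by (auto simp: lambda_free_def H_asymptotic_def)
  then have "field K" by (simp add: asymptotic_def valued_diff_field_def)
  then interpret K: H_asymptotic_field K
    using K_asym by (auto intro!: H_asymptotic_field.intro asymptotic_field.intro
        asymptotic_field_axioms.intro H_asymptotic_field_axioms.intro)
  have hom: "i \<in> ring_hom K L" using e by (simp add: vdf_emb_def)
  interpret h: ring_hom_ring K L i
    by (intro ring_hom_ringI2 hom K.ring_axioms ring_axioms)
  have D_i: "D (i x) = i (vder K x)" if "x \<in> carrier K" for x
    using e that by (simp add: vdf_emb_def)
  have dom_i: "i x \<preceq> i y \<longleftrightarrow> vdom K x y" if "x \<in> carrier K" "y \<in> carrier K" for x y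
    using e that by (simp add: vdf_emb_def)
  \<comment> \<open>Injectivity at zero comes from the valuation: the embedding reflects dominance,
    and only zero is dominated by zero.\<close>
  have nz_i: "i x \<noteq> \<zero>" if "x \<in> carrier K" "x \<noteq> \<zero>\<^bsub>K\<^esub>" for x
    using dom_i[of x "\<zero>\<^bsub>K\<^esub>"] K.dom_zero[of x] that by auto
  have inv_i: "inv (i x) = i (inv\<^bsub>K\<^esub> x)" if x: "x \<in> carrier K" "x \<noteq> \<zero>\<^bsub>K\<^esub>" for x
  proof (rule comm_inv_char)
    have "i (x \<otimes>\<^bsub>K\<^esub> inv\<^bsub>K\<^esub> x) = i x \<otimes> i (inv\<^bsub>K\<^esub> x)" using x by (intro h.hom_mult) auto
    then show "i x \<otimes> i (inv\<^bsub>K\<^esub> x) = \<one>" using x by simp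
  qed (use x in auto)
  have ld_i: "ld (i x) = i (ldv K x)" if "x \<in> carrier K" "x \<noteq> \<zero>\<^bsub>K\<^esub>" for x
    using that by (simp add: ldv_def D_i inv_i)
  have diff_i: "i x \<ominus> i y = i (x \<ominus>\<^bsub>K\<^esub> y)" if "x \<in> carrier K" "y \<in> carrier K" for x y
    using that by (simp add: minus_eq K.minus_eq)
  show ?thesis
  proof (intro lambda_free_subfield.intro lambda_free_subfield_axioms.intro H_asymptotic_field_axioms)
    show "subfield (i ` carrier K) L"
      using h.img_is_subfield(2)[OF K.carrier_is_subfield] by simp
  next
    fix x assume "x \<in> i ` carrier K"
    then show "D x \<in> i ` carrier K" using D_i by auto
  next
    fix s assume "s \<in> i ` carrier K"
    then obtain t where t: "t \<in> carrier K" "s = i t" by auto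
    obtain g where g: "g \<in> carrier K" "\<not> vdom K g \<one>\<^bsub>K\<^esub>"
      "vdom K (ldv K g) (t \<ominus>\<^bsub>K\<^esub> ldv K (ldv K g))"
      using lf t by (auto simp: lambda_free_def prec_def preceq_def)
    have g0: "g \<noteq> \<zero>\<^bsub>K\<^esub>" using g(1,2) by auto
    have lg: "ldv K g \<in> carrier K" "ldv K g \<noteq> \<zero>\<^bsub>K\<^esub>" using g g0 K.ldv_nonzero[of g] by auto
    have "\<one> \<prec> i g" using dom_i[of g "\<one>\<^bsub>K\<^esub>"] g by simp
    moreover have "ld (i g) \<preceq> s \<ominus> ld (ld (i g))"
      using g g0 lg t by (simp add: ld_i diff_i dom_i)
    ultimately show "\<exists>g\<in>i ` carrier K. \<one> \<prec> g \<and> ld g \<preceq> s \<ominus> ld (ld g)" using g by blast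
  next
    fix g assume g: "g \<in> i ` carrier K" "g \<noteq> \<zero>" "g \<prec> \<one>"
    then obtain x where x: "x \<in> carrier K" "g = i x" by auto
    have x0: "x \<noteq> \<zero>\<^bsub>K\<^esub>" using x g by auto
    have "\<not> vdom K \<one>\<^bsub>K\<^esub> x" using dom_i[of "\<one>\<^bsub>K\<^esub>" x] g x by simp
    then have "\<not> asymp K x \<one>\<^bsub>K\<^esub>" by (simp add: asymp_def)
    then obtain y where y: "y \<in> carrier K" "y \<noteq> \<zero>\<^bsub>K\<^esub>" "\<not> asymp K y \<one>\<^bsub>K\<^esub>"
      "\<not> vdom K (ldv K x) (ldv K y)"
      using lf x x0 by (auto simp: lambda_free_def grounded_def preceq_def)
    \<comment> \<open>A witness larger than 1 is replaced by its inverse, which has the same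
      logarithmic derivative up to sign.\<close>
    have "\<exists>y\<in>carrier K. y \<noteq> \<zero>\<^bsub>K\<^esub> \<and> \<not> vdom K \<one>\<^bsub>K\<^esub> y \<and> \<not> vdom K (ldv K x) (ldv K y)"
    proof (cases "vdom K \<one>\<^bsub>K\<^esub> y")
      case True
      then have "\<not> vdom K y \<one>\<^bsub>K\<^esub>" using y by (simp add: asymp_def)
      then have "\<not> vdom K \<one>\<^bsub>K\<^esub> (inv\<^bsub>K\<^esub> y)" using y K.inv_sdom_one_iff by simp
      then show ?thesis using y x x0 by (intro bexI[of _ "inv\<^bsub>K\<^esub> y"]) (auto simp: K.ldv_inv)
    next
      case False
      then show ?thesis using y by blast
    qed
    then obtain y where y: "y \<in> carrier K" "y \<noteq> \<zero>\<^bsub>K\<^esub>" "\<not> vdom K \<one>\<^bsub>K\<^esub> y" "\<not> vdom K (ldv K x) (ldv K y)"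
      by blast
    then have "i y \<noteq> \<zero>" "i y \<prec> \<one>" "ld (i y) \<prec> ld g"
      using nz_i dom_i[of "\<one>\<^bsub>K\<^esub>" y] x x0 by (auto simp: ld_i dom_i)
    then show "\<exists>h\<in>i ` carrier K. h \<noteq> \<zero> \<and> h \<prec> \<one> \<and> ld h \<prec> ld g" using y by blast
  qed
qed

text \<open>Since the universal property of \<open>dv_hull\<close> only quantifies over structures on the type of \<open>L\<close>,
  it is applied to substructures of \<open>L\<close> itself.\<close>
lemma dv_hull_minimal:
  assumes hull: "dv_hull K L i" and E: "i ` carrier K \<subseteq> E" "E \<subseteq> carrier L"
    and M: "d_valued (L\<lparr>carrier := E\<rparr>)" "H_type (L\<lparr>carrier := E\<rparr>)"
  shows "E = carrier L"
proof
  note h = hull[unfolded dv_hull_def]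
  note univ = h[THEN conjunct2, THEN conjunct2, THEN conjunct2]
  have L: "d_valued L" "H_type L" and i: "vdf_emb i K L" using h by blast+
  have "vdf_emb i K (L\<lparr>carrier := E\<rparr>)"
    using i E(1) by (auto simp: vdf_emb_def ring_hom_def)
  then obtain j where j: "vdf_emb j L (L\<lparr>carrier := E\<rparr>)" "\<forall>x\<in>carrier K. j (i x) = i x"
    using univ M by blast
  have jE: "j y \<in> E" if "y \<in> carrier L" for y
    using j(1) that by (auto simp: vdf_emb_def ring_hom_def)
  \<comment> \<open>Followed by the inclusion of \<open>E\<close>, the map \<open>j\<close> is an
    embedding of \<open>L\<close> into itself that fixes the image of \<open>K\<close>. The identity
    is another, so uniqueness makes \<open>j\<close> the identity, although its values lie in
    \<open>E\<close>.\<close>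
  have j': "vdf_emb j L L" using j(1) E(2) by (auto simp: vdf_emb_def ring_hom_def)
  have id: "vdf_emb id L L" by (auto simp: vdf_emb_def ring_hom_def)
  obtain k where k: "\<And>j'. vdf_emb j' L L \<Longrightarrow> \<forall>x\<in>carrier K. j' (i x) = i x \<Longrightarrow> \<forall>y\<in>carrier L. j' y = k y"
    using univ L i by blast
  have "j y = y" if "y \<in> carrier L" for y
    using k[OF j' j(2)] k[OF id] that by simp
  then show "carrier L \<subseteq> E" using jE by fastforce
qed (rule E(2))

theorem theorem10p2:
  fixes K :: "'k vdf" and L :: "'a vdf" and i :: "'k \<Rightarrow> 'a"
  assumes "pre_d_valued K" and "H_type K"
    and "dv_hull K L i"
    and "lambda_free K"
  shows "lambda_free L"
proof -
  have dL: "d_valued L" and HL: "H_type L" and i: "vdf_emb i K L"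
    using assms(3) by (auto simp: dv_hull_def)
  then have aL: "asymptotic L" by (simp add: d_valued_def)
  then have "field L" by (simp add: asymptotic_def valued_diff_field_def)
  then interpret H_asymptotic_field L
    using aL HL by (auto intro!: H_asymptotic_field.intro asymptotic_field.intro
        asymptotic_field_axioms.intro H_asymptotic_field_axioms.intro)
  interpret lambda_free_subfield L "i ` carrier K"
    using embedding_lambda_free_subfield[OF i assms(4)] .
  \<comment> \<open>By minimality of the hull, what was proved for the extension of \<open>F\<close>
    by constants now holds for all of \<open>L\<close>.\<close>
  have "const_ext = carrier L"
    using dv_hull_minimal[OF assms(3), of const_ext] const_ext_d_valued[OF dL] restrict_H_type[OF const_ext_subfield const_ext_D]
      F_subset_const_alg const_alg_subset_ext const_ext_carrier by blast
  then have all: "x \<in> const_ext" if "x \<in> carrier L" for x using that by simp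
  show ?thesis
    unfolding lambda_free_def
  proof (intro conjI ballI)
    show "H_asymptotic L" using aL HL by (simp add: H_asymptotic_def)
    show "\<not> grounded L"
    proof
      assume "grounded L"
      then obtain g where g: "g \<in> carrier L" "g \<noteq> \<zero>\<^bsub>L\<^esub>" "\<not> asymp L g \<one>\<^bsub>L\<^esub>"
        "\<And>h. h \<in> nonzero L \<Longrightarrow> \<not> asymp L h \<one>\<^bsub>L\<^esub> \<Longrightarrow> vdom L (ldv L g) (ldv L h)"
        unfolding grounded_def preceq_def by blast
      then obtain h where "h \<in> i ` carrier K" "h \<noteq> \<zero>\<^bsub>L\<^esub>" "\<not> vdom L \<one>\<^bsub>L\<^esub> h" "\<not> vdom L (ldv L g) (ldv L h)"
        using const_ext_not_grounded[OF all[OF g(1)] g(2)] unfolding asymp_def by blast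
      then show False using g(4)[of h] F_carrier unfolding asymp_def by blast
    qed
    obtain g where g: "g \<in> i ` carrier K" "\<not> vdom L g \<one>\<^bsub>L\<^esub>" using lambda[OF F_zero] by blast
    then have "g \<noteq> \<zero>\<^bsub>L\<^esub>" by auto
    then show "nontrivial_value_group L"
      using g F_carrier unfolding nontrivial_value_group_def asymp_def by blast
  next
    fix s assume s: "s \<in> carrier L"
    then obtain g where "g \<in> i ` carrier K" "\<not> vdom L g \<one>\<^bsub>L\<^esub>"
      "vdom L (ldv L g) (s \<ominus>\<^bsub>L\<^esub> ldv L (ldv L g))" using const_ext_lambda all by blast
    then show "\<exists>g\<in>carrier L. prec L \<one>\<^bsub>L\<^esub> g \<and> preceq L (ldv L g) (s \<ominus>\<^bsub>L\<^esub> ldv L (ldv L g))"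
      using prec_iff[of "\<one>\<^bsub>L\<^esub>"] F_carrier one_closed unfolding preceq_def by blast
  qed
qed

end
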